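(* Let $\sigma_{1/2}:\mathbb{R}^2\to\{0,1\}$ be planar critical Voronoi percolation (parameter $p=1/2$). For $R>1$ let $\mathrm{Cross}_0(A_R)$ be the event that there exists a continuous path included in $\{\sigma_{1/2}=0\}$ crossing the annulus $A_R=B(0,R)\setminus B(0,1)$, i.e. joining $S(0,1)$ to $S(0,R)$. Then $$\forall\eta>0,\quad\limsup_{R\to\infty}R^{1+\eta}\,\mathbb{P}[\mathrm{Cross}_0(A_R)]>0.$$
   Context: Voronoi percolation with parameter $p$ in the plane: let $X$ be a Poisson point process on $\mathbb{R}^2$ of intensity $1$. Each $x\in X$ has a Voronoi cell $V_x$, the set of points of $\mathbb{R}^2$ at least as close to $x$ as to any other point of $X$. Independently over cells, each cell is coloured black (value $1$) with probability $1-p$ or white (value $0$) with probability $p$. The boundaries between two cells of different colours are coloured white. This defines $\sigma_p:\mathbb{R}^2\to\{0,1\}$. $B(0,r)$ and $S(0,r)$ are the Euclidean ball and sphere. *)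

theory Defs
  imports "HOL-Probability.Probability"
begin

text \<open>
  The point processes below are proper: they are given by a sequence of random points
  \<open>X 0, X 1, \<dots>\<close>, and stand for the random measure \<open>\<Sum>n. \<delta>(X n)\<close>. A Poisson process whose
  intensity has infinite total mass has almost surely infinitely many points, so for such
  intensities nothing is lost by indexing the points by all natural numbers.
\<close>

definition point_count :: "(nat \<Rightarrow> 'w \<Rightarrow> 'b) \<Rightarrow> 'b set \<Rightarrow> 'w \<Rightarrow> ennreal" where
  "point_count X A \<omega> = (\<Sum>n. indicator A (X n \<omega>))"

text \<open>
  Local finiteness and (for diffuse intensities) distinctness of the points
  hold almost surely as consequences of the Poisson law of the counts, which count multiplicities.
\<close>

definition poisson_process :: "'w measure \<Rightarrow> 'b measure \<Rightarrow> (nat \<Rightarrow> 'w \<Rightarrow> 'b) \<Rightarrow> bool" where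
  "poisson_process M \<Lambda> X \<longleftrightarrow>
     (\<forall>n. X n \<in> M \<rightarrow>\<^sub>M \<Lambda>) \<and>
     (\<forall>A \<in> sets \<Lambda>. emeasure \<Lambda> A < \<infinity> \<longrightarrow>
        (\<forall>k. measure M {\<omega> \<in> space M. point_count X A \<omega> = of_nat k}
               = exp (- measure \<Lambda> A) * measure \<Lambda> A ^ k / fact k)) \<and>
     (\<forall>(m::nat) A. A ` {..<m} \<subseteq> sets \<Lambda> \<and> disjoint_family_on A {..<m} \<longrightarrow>
        prob_space.indep_vars M (\<lambda>_. borel) (\<lambda>i. point_count X (A i)) {..<m})"

definition voronoi_cell :: "'b::metric_space set \<Rightarrow> 'b \<Rightarrow> 'b set" where
  "voronoi_cell S x = {y. \<forall>z\<in>S. dist y x \<le> dist y z}"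

text \<open>\<open>B n \<omega>\<close> says that the cell of the point \<open>X n \<omega>\<close> is black.\<close>

locale voronoi_percolation = prob_space M
  for M :: "'w measure" and p :: real and X :: "nat \<Rightarrow> 'w \<Rightarrow> real^2" and B :: "nat \<Rightarrow> 'w \<Rightarrow> bool" +
  assumes poisson: "poisson_process M lborel X"
    and black_indep: "indep_vars (\<lambda>_. count_space UNIV) B UNIV"
    and black_prob: "prob {\<omega> \<in> space M. B n \<omega>} = 1 - p"
    and black_indep_points:
      "indep_set (sets (vimage_algebra (space M) (\<lambda>\<omega> n. X n \<omega>) (\<Pi>\<^sub>M n\<in>UNIV. borel)))
                 (sets (vimage_algebra (space M) (\<lambda>\<omega> n. B n \<omega>) (\<Pi>\<^sub>M n\<in>UNIV. count_space UNIV)))"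

text \<open>
  Cells are closed, so a point on the boundary between a white and a black cell belongs to both;
  it gets colour \<open>0\<close> (white).
\<close>

definition voronoi_colouring ::
    "(nat \<Rightarrow> 'w \<Rightarrow> real^2) \<Rightarrow> (nat \<Rightarrow> 'w \<Rightarrow> bool) \<Rightarrow> 'w \<Rightarrow> real^2 \<Rightarrow> nat" where
  "voronoi_colouring X B \<omega> y =
     (if \<exists>n. y \<in> voronoi_cell (range (\<lambda>k. X k \<omega>)) (X n \<omega>) \<and> \<not> B n \<omega> then 0 else 1)"

definition crosses_annulus :: "(real^2) set \<Rightarrow> real \<Rightarrow> bool" where
  "crosses_annulus F R \<longleftrightarrow>
     (\<exists>g. path g \<and> path_image g \<subseteq> F \<and> pathstart g \<in> sphere 0 1 \<and> pathfinish g \<in> sphere 0 R)"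

text \<open>
  Since \<open>X\<close> is locally finite only almost surely, this set is an event up to a null set:
  its probability is to be taken with respect to \<open>completion M\<close>.
\<close>

definition Cross0 ::
    "'w measure \<Rightarrow> (nat \<Rightarrow> 'w \<Rightarrow> real^2) \<Rightarrow> (nat \<Rightarrow> 'w \<Rightarrow> bool) \<Rightarrow> real \<Rightarrow> 'w set" where
  "Cross0 M X B R = {\<omega> \<in> space M. crosses_annulus {y. voronoi_colouring X B \<omega> y = 0} R}"

end

theory Submission
  imports Defs
begin

text \<open>
  Either the white region crosses the square \<open>[-a, a]\<^sup>2\<close> from left to right, or the closed black
  region crosses it from bottom to top (a Hex argument, obtained from Brouwer's theorem). At
  \<open>p = 1/2\<close> the two have the same probability by exchanging the colours and reflecting in the
  diagonal, so a white crossing has probability at least \<open>1/2\<close>. Such a crossing meets the vertical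
  axis, hence one of the \<open>O(a)\<close> unit discs centred at the points \<open>(0, i)\<close>, and from that disc it reaches
  distance \<open>a\<close>. By translation invariance and the union bound the one-arm probability is at least
  \<open>1 / (10 * a)\<close>.

  Invariance and measurability are reduced to the random pair (white points, black points): its law is
  determined by the void probabilities, which depend on the test sets only through their areas.
\<close>

text \<open>The points are indexed in an arbitrary order, so the law of the counts does not
  determine that of the sequence \<open>X\<close>, and a translated or reflected sequence need not
  have the law of \<open>X\<close>. Only the unordered coloured configuration carries the
  symmetries. Its void probability is exp(-(|A| + |A'|) / 2), that of two independent Poisson
  processes of intensity 1/2; translations, the reflection and the exchange of colours all preserve
  |A| + |A'|.

  Duality is used with both colours closed: points equidistant from the two colours lie in both
  regions, so the regions cover the plane and ties need not be shown negligible. The overlap does no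
  harm to a lower bound of 1/2.

  Connected sets give measurability, while \<open>Cross0\<close> speaks of paths. The two agree
  almost surely, because a bounded part of the white region lies in finitely many closed convex
  cells.

  The constant 10 is 2 * 5: a crossing has probability at least 1/2, and there are at most 5 * a
  discs.\<close>

subsection \<open>Connections and the Hex theorem on a square\<close>

text \<open>Connected sets instead of paths: the existence of a connecting set is stable under limits, so
  that for closed random \<open>F\<close> the corresponding event is measurable.\<close>

definition connects :: "'a::topological_space set \<Rightarrow> 'a set \<Rightarrow> 'a set \<Rightarrow> 'a set \<Rightarrow> bool" where
  "connects F K S T \<longleftrightarrow> (\<exists>C. connected C \<and> C \<subseteq> F \<inter> K \<and> C \<inter> S \<noteq> {} \<and> C \<inter> T \<noteq> {})"

text \<open>A compact \<open>F \<inter> K\<close> that does not connect \<open>S\<close> to \<open>T\<close> splits into two clopen parts; \<open>U\<close> stands for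
  a neighbourhood of the part meeting \<open>S\<close>, and \<open>F\<close> misses \<open>barrier K S T U\<close>.\<close>

definition barrier :: "'a::topological_space set \<Rightarrow> 'a set \<Rightarrow> 'a set \<Rightarrow> 'a set \<Rightarrow> 'a set" where
  "barrier K S T U = K \<inter> ((S - U) \<union> (T \<inter> closure U) \<union> frontier U)"

lemma connects_mono:
  assumes "connects F K S T" "F \<subseteq> F'" "K \<subseteq> K'" "S \<subseteq> S'" "T \<subseteq> T'"
  shows "connects F' K' S' T'"
proof -
  from assms(1) obtain C where "connected C" "C \<subseteq> F \<inter> K" "C \<inter> S \<noteq> {}" "C \<inter> T \<noteq> {}"
    unfolding connects_def by blast
  then have "connected C \<and> C \<subseteq> F' \<inter> K' \<and> C \<inter> S' \<noteq> {} \<and> C \<inter> T' \<noteq> {}"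
    using assms(2-5) by blast
  then show ?thesis unfolding connects_def by blast
qed

lemma connects_image:
  assumes "connects F K S T" "continuous_on UNIV f"
  shows "connects (f ` F) (f ` K) (f ` S) (f ` T)"
proof -
  from assms(1) obtain C where C: "connected C" "C \<subseteq> F \<inter> K" "C \<inter> S \<noteq> {}" "C \<inter> T \<noteq> {}"
    unfolding connects_def by blast
  have "connected (f ` C)"
    using C(1) assms(2) by (meson connected_continuous_image continuous_on_subset subset_UNIV)
  moreover have "f ` C \<subseteq> f ` F \<inter> f ` K" "f ` C \<inter> f ` S \<noteq> {}" "f ` C \<inter> f ` T \<noteq> {}"
    using C by auto
  ultimately show ?thesis
    unfolding connects_def by blast
qed

text \<open>By Sura-Bura, a component of a compact set has arbitrarily small clopen neighbourhoods.
  The component of a point of \<open>S\<close> misses \<open>T\<close>, hence so does some clopen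
  neighbourhood, and finitely many of these cover \<open>W \<inter> S\<close>.\<close>

lemma compact_clopen_separation:
  fixes W :: "'a::euclidean_space set"
  assumes W: "compact W" and S: "closed S" and T: "closed T"
    and no: "\<And>C. connected C \<Longrightarrow> C \<subseteq> W \<Longrightarrow> C \<inter> S \<noteq> {} \<Longrightarrow> C \<inter> T = {}"
  obtains H where "openin (top_of_set W) H" "compact H" "W \<inter> S \<subseteq> H" "H \<inter> T = {}"
proof -
  have "\<exists>H. openin (top_of_set W) H \<and> compact H \<and> x \<in> H \<and> H \<inter> T = {}" if x: "x \<in> W \<inter> S" for x
  proof -
    define C where "C = connected_component_set W x"
    have C: "C \<in> components W" "x \<in> C"
      using x by (auto simp: C_def components_def)
    have "C \<inter> T = {}"
      using no[of C] x C(2) connected_component_subset[of W x]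
      by (metis C_def IntD2 connected_connected_component disjoint_iff)
    then have "C \<subseteq> - T" by blast
    moreover have "compact C" using W C(1) by (rule compact_components)
    ultimately obtain H where "openin (top_of_set W) H" "compact H" "C \<subseteq> H" "H \<subseteq> - T"
      using Sura_Bura_clopen_subset[of W C "- T"] W C(1) T closed_imp_locally_compact compact_imp_closed
      by (metis open_Compl)
    then show ?thesis using C(2) by blast
  qed
  then obtain h where h: "\<And>x. x \<in> W \<inter> S \<Longrightarrow>
      openin (top_of_set W) (h x) \<and> compact (h x) \<and> x \<in> h x \<and> h x \<inter> T = {}"
    by metis
  then obtain g where g: "\<And>x. x \<in> W \<inter> S \<Longrightarrow> open (g x) \<and> h x = W \<inter> g x"
    unfolding openin_open by metis
  have "compact (W \<inter> S)" using W S by blast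
  then obtain D where D: "D \<subseteq> W \<inter> S" "finite D" "W \<inter> S \<subseteq> (\<Union>x\<in>D. g x)"
  proof (rule compactE_image[of "W \<inter> S" "W \<inter> S" g])
    show "W \<inter> S \<subseteq> (\<Union>x\<in>W \<inter> S. g x)" using g h by blast
  qed (use g in auto)
  show ?thesis
  proof
    show "openin (top_of_set W) (\<Union>x\<in>D. h x)" using h D(1) by (intro openin_Union) auto
    show "compact (\<Union>x\<in>D. h x)" using h D(1,2) by (intro compact_UN) auto
    show "W \<inter> S \<subseteq> (\<Union>x\<in>D. h x)"
    proof
      fix y assume y: "y \<in> W \<inter> S"
      then obtain x where x: "x \<in> D" "y \<in> g x" using D(3) by auto
      with g D(1) y have "y \<in> h x" by blast
      with x show "y \<in> (\<Union>x\<in>D. h x)" by blast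
    qed
    show "(\<Union>x\<in>D. h x) \<inter> T = {}" using h D(1) by blast
  qed
qed

text \<open>The clopen part containing \<open>S\<close> is thickened to an open \<open>U\<close>
  whose closure avoids the other part; conversely, a connected set joining \<open>S\<close> to
  \<open>T\<close> would have to cross \<open>frontier U\<close>. Compactness allows
  \<open>U\<close> to be a finite union of basic sets, so with a countable basis non-connection
  becomes a countable union of avoidance conditions.\<close>

lemma not_connects_iff_barrier:
  fixes F :: "'a::euclidean_space set"
  assumes basis: "topological_basis \<B>" and F: "closed F" and K: "compact K"
    and S: "closed S" and T: "closed T"
  shows "\<not> connects F K S T \<longleftrightarrow> (\<exists>\<U>. finite \<U> \<and> \<U> \<subseteq> \<B> \<and> F \<inter> barrier K S T (\<Union>\<U>) = {})"
proof
  assume no: "\<not> connects F K S T"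
  define W where "W = F \<inter> K"
  have W: "compact W" using F K by (auto simp: W_def closed_Int_compact)
  obtain H where H: "openin (top_of_set W) H" "compact H" "W \<inter> S \<subseteq> H" "H \<inter> T = {}"
    by (rule compact_clopen_separation[OF W S T]) (use no in \<open>auto simp: connects_def W_def\<close>)
  have "closedin (top_of_set W) (W - H)"
    using H(1) by (metis closedin_diff closedin_topspace topspace_euclidean_subtopology)
  then have cl: "closed (W - H)"
    using W closedin_compact compact_imp_closed by blast
  \<comment> \<open>Closures, not just basic sets, must avoid \<open>W - H\<close>: then no point of
    \<open>W\<close> can lie on the frontier of their union.\<close>
  have "\<exists>b. b \<in> \<B> \<and> x \<in> b \<and> closure b \<inter> (W - H) = {}" if x: "x \<in> H" for x
  proof -
    have "open (- (W - H))" using cl by (rule open_Compl)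
    moreover have "x \<in> - (W - H)" using x by blast
    ultimately obtain e where e: "e > 0" "cball x e \<subseteq> - (W - H)" by (meson open_contains_cball)
    obtain b where b: "b \<in> \<B>" "x \<in> b" "b \<subseteq> ball x e"
      using topological_basisE[OF basis open_ball, of x x e] e(1) by auto
    then have "closure b \<subseteq> cball x e"
      by (meson ball_subset_cball closed_cball closure_minimal order_trans)
    with b e show ?thesis by blast
  qed
  then obtain b where b: "\<And>x. x \<in> H \<Longrightarrow> b x \<in> \<B> \<and> x \<in> b x \<and> closure (b x) \<inter> (W - H) = {}"
    by metis
  obtain D where D: "D \<subseteq> H" "finite D" "H \<subseteq> (\<Union>x\<in>D. b x)"
  proof (rule compactE_image[OF H(2), of H b])
    show "\<And>x. x \<in> H \<Longrightarrow> open (b x)" using b basis topological_basis_open by blast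
  qed (use b in auto)
  define U where "U = (\<Union>x\<in>D. b x)"
  have U: "open U" unfolding U_def using b D(1) basis topological_basis_open by blast
  have clU: "closure U \<inter> (W - H) = {}"
  proof -
    have "closure U \<subseteq> (\<Union>x\<in>D. closure (b x))"
      unfolding U_def
    proof (rule closure_minimal)
      show "closed (\<Union>x\<in>D. closure (b x))" using D(2) by (intro closed_UN) auto
    qed (use closure_subset in blast)
    then show ?thesis using b D(1) by blast
  qed
  have HU: "H \<subseteq> U" using D(3) by (simp add: U_def)
  have fr: "frontier U = closure U - U" using U by (simp add: frontier_def interior_open)
  have "F \<inter> barrier K S T U = W \<inter> ((S - U) \<union> (T \<inter> closure U) \<union> frontier U)"
    by (auto simp: barrier_def W_def)
  also have "\<dots> = {}"
    using H(3,4) HU clU unfolding fr by blast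
  finally have "F \<inter> barrier K S T U = {}" .
  moreover have "finite (b ` D)" "b ` D \<subseteq> \<B>" "U = \<Union>(b ` D)" using D(1,2) b by (auto simp: U_def)
  ultimately show "\<exists>\<U>. finite \<U> \<and> \<U> \<subseteq> \<B> \<and> F \<inter> barrier K S T (\<Union>\<U>) = {}" by metis
next
  assume "\<exists>\<U>. finite \<U> \<and> \<U> \<subseteq> \<B> \<and> F \<inter> barrier K S T (\<Union>\<U>) = {}"
  then obtain U where U: "F \<inter> barrier K S T U = {}" by blast
  show "\<not> connects F K S T"
  proof
    assume "connects F K S T"
    then obtain C where C: "connected C" "C \<subseteq> F \<inter> K" "C \<inter> S \<noteq> {}" "C \<inter> T \<noteq> {}"
      unfolding connects_def by blast
    have "C \<inter> U \<noteq> {}" using U C(2,3) unfolding barrier_def by blast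
    moreover have "C - U \<noteq> {}" using U C(2,4) closure_subset[of U] unfolding barrier_def by blast
    ultimately have "C \<inter> frontier U \<noteq> {}" using connected_Int_frontier[OF C(1)] by blast
    then show False using U C(2) unfolding barrier_def by blast
  qed
qed

section \<open>The Hex theorem from Brouwer's fixed point theorem\<close>

definition square :: "real \<Rightarrow> (real^2) set" where
  "square a = {x. \<bar>x $ 1\<bar> \<le> a \<and> \<bar>x $ 2\<bar> \<le> a}"

lemma square_eq_cbox: "square a = cbox (\<chi> i. -a) (\<chi> i. a)"
  by (auto simp: square_def mem_box_cart forall_2 abs_le_iff)

lemma compact_square: "compact (square a)"
  by (simp add: square_eq_cbox)

text \<open>Brouwer is applied to the map that moves x by -(u x, v x) and then clamps each
  coordinate to [-a, a]. The boundary signs make this displacement point inwards on every side, so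
  at a fixed point the clamping hides no nonzero displacement.\<close>

lemma poincare_miranda_square:
  fixes u v :: "real^2 \<Rightarrow> real"
  assumes a: "a > 0" and u: "continuous_on UNIV u" and v: "continuous_on UNIV v"
    and "\<And>x. x \<in> square a \<Longrightarrow> x $ 1 = -a \<Longrightarrow> u x < 0"
    and "\<And>x. x \<in> square a \<Longrightarrow> x $ 1 = a \<Longrightarrow> u x > 0"
    and "\<And>x. x \<in> square a \<Longrightarrow> x $ 2 = -a \<Longrightarrow> v x < 0"
    and "\<And>x. x \<in> square a \<Longrightarrow> x $ 2 = a \<Longrightarrow> v x > 0"
  obtains x where "x \<in> square a" "u x = 0" "v x = 0"
proof -
  define c where "c = (\<lambda>t. max (-a) (min a t))"
  define f :: "real^2 \<Rightarrow> real^2" where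
    "f = (\<lambda>x. \<chi> i. if i = 1 then c (x $ 1 - u x) else c (x $ 2 - v x))"
  have f1: "f x $ 1 = c (x $ 1 - u x)" and f2: "f x $ 2 = c (x $ 2 - v x)" for x
    by (auto simp: f_def)
  obtain x where x: "x \<in> square a" "f x = x"
  proof (rule brouwer[of "square a" f])
    show "compact (square a)" by (rule compact_square)
    show "convex (square a)" by (simp add: square_eq_cbox)
    have "0 \<in> square a" using a by (simp add: square_def)
    then show "square a \<noteq> {}" by blast
    have "continuous_on UNIV f"
      unfolding f_def c_def
    proof (rule continuous_on_vec_lambda)
      show "continuous_on UNIV (\<lambda>x. if i = 1 then max (- a) (min a (x $ 1 - u x))
            else max (- a) (min a (x $ 2 - v x)))" for i :: 2
        by (cases "i = 1") (auto intro!: continuous_intros u v)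
    qed
    then show "continuous_on (square a) f" using continuous_on_subset by blast
    show "f \<in> square a \<rightarrow> square a" using a by (auto simp: square_def f1 f2 c_def)
  qed
  have fixed: "w = 0" if eq: "c (t - w) = t" and lo: "t = -a \<Longrightarrow> w < 0" and hi: "t = a \<Longrightarrow> w > 0" for t w
    using eq lo hi a unfolding c_def max_def min_def by (auto split: if_splits)
  show ?thesis
  proof
    show "u x = 0"
      using fixed[of "x $ 1" "u x"] f1[of x] x assms(4,5) by auto
    show "v x = 0"
      using fixed[of "x $ 2" "v x"] f2[of x] x assms(6,7) by auto
  qed (fact x(1))
qed

text \<open>A barrier splits \<open>F \<inter> K\<close> into two closed parts, one joined with the
  \<open>S\<close> side and one with the \<open>T\<close> side; the difference of the distances to
  these disjoint closed sets separates them by sign.\<close>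

lemma not_connects_signed_function:
  fixes F :: "'a::euclidean_space set"
  assumes F: "closed F" and K: "compact K" and S: "closed S" and T: "closed T"
    and ST: "S \<inter> T = {}" and no: "\<not> connects F K S T"
  obtains u :: "'a \<Rightarrow> real" where "continuous_on UNIV u" "\<And>x. x \<in> S \<inter> K \<Longrightarrow> u x < 0"
    "\<And>x. x \<in> T \<inter> K \<Longrightarrow> u x > 0" "\<And>x. x \<in> F \<inter> K \<Longrightarrow> u x \<noteq> 0"
proof -
  obtain \<B> :: "'a set set" where B: "topological_basis \<B>" using ex_countable_basis by blast
  obtain \<U> where \<U>: "\<U> \<subseteq> \<B>" and bar: "F \<inter> barrier K S T (\<Union>\<U>) = {}"
    using no not_connects_iff_barrier[OF B F K S T] by blast
  define U where "U = \<Union>\<U>"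
  have U: "open U" using \<U> B topological_basis_open unfolding U_def by blast
  have bar: "F \<inter> barrier K S T U = {}" using bar by (simp add: U_def)
  have fr: "frontier U = closure U - U" using U by (simp add: frontier_def interior_open)
  define K1 where "K1 = (F \<inter> K \<inter> closure U) \<union> (S \<inter> K)"
  define K2 where "K2 = (F \<inter> K - U) \<union> (T \<inter> K)"
  have FK: "closed (F \<inter> K)" "closed (S \<inter> K)" "closed (T \<inter> K)"
    using F S T K by (auto simp: compact_imp_closed)
  have cl1: "closed K1" and cl2: "closed K2"
    unfolding K1_def K2_def using FK U by auto
  have dis: "K1 \<inter> K2 = {}"
    using bar ST closure_subset[of U] unfolding barrier_def fr K1_def K2_def by blast
  have cov: "F \<inter> K \<subseteq> K1 \<union> K2" using closure_subset[of U] by (auto simp: K1_def K2_def)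
  show ?thesis
  \<comment> \<open>\<open>infdist\<close> to the empty set is 0, so the difference of distances
    loses its sign when a part is empty; a constant function then serves.\<close>
  proof (cases "K1 = {} \<or> K2 = {}")
    case True
    then have "(\<forall>x\<in>S \<inter> K. False) \<or> (\<forall>x\<in>T \<inter> K. False)" by (auto simp: K1_def K2_def)
    then show ?thesis
    proof
      assume *: "\<forall>x\<in>S \<inter> K. False"
      show ?thesis by (rule that[of "\<lambda>_. 1"]) (use * in auto)
    next
      assume *: "\<forall>x\<in>T \<inter> K. False"
      show ?thesis by (rule that[of "\<lambda>_. -1"]) (use * in auto)
    qed
  next
    case False
    define u where "u = (\<lambda>x. infdist x K1 - infdist x K2)"
    have neg: "u x < 0" if "x \<in> K1" for x
      using that False dis infdist_pos_not_in_closed[OF cl2, of x] by (auto simp: u_def)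
    have pos: "u x > 0" if "x \<in> K2" for x
      using that False dis infdist_pos_not_in_closed[OF cl1, of x] by (auto simp: u_def)
    show ?thesis
    proof (rule that[of u])
      show "continuous_on UNIV u" unfolding u_def by (intro continuous_intros)
      show "u x < 0" if "x \<in> S \<inter> K" for x using that neg by (auto simp: K1_def)
      show "u x > 0" if "x \<in> T \<inter> K" for x using that pos by (auto simp: K2_def)
      show "u x \<noteq> 0" if "x \<in> F \<inter> K" for x using that neg[of x] pos[of x] cov by fastforce
    qed
  qed
qed

lemma closed_coordinate_line: "closed {x::real^2. x $ i = c}"
  by (intro closed_Collect_eq continuous_intros)

text \<open>If both crossings failed, the two sign functions would have a common zero in the square.
  It could lie neither in \<open>F\<close> nor in \<open>G\<close>, although these cover the
  plane.\<close>

lemma hex_square: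
  assumes a: "a > 0" and F: "closed F" and G: "closed G" and FG: "F \<union> G = UNIV"
  shows "connects F (square a) {x. x $ 1 = -a} {x. x $ 1 = a} \<or>
         connects G (square a) {x. x $ 2 = -a} {x. x $ 2 = a}"
proof (rule ccontr)
  assume "\<not> ?thesis"
  then have no: "\<not> connects F (square a) {x. x $ 1 = -a} {x. x $ 1 = a}"
    "\<not> connects G (square a) {x. x $ 2 = -a} {x. x $ 2 = a}" by auto
  have disj: "{x::real^2. x $ i = -a} \<inter> {x. x $ i = a} = {}" for i using a by auto
  obtain u where u: "continuous_on UNIV u"
    "\<And>x. x \<in> {x. x $ 1 = -a} \<inter> square a \<Longrightarrow> u x < (0::real)"
    "\<And>x. x \<in> {x. x $ 1 = a} \<inter> square a \<Longrightarrow> u x > 0" "\<And>x. x \<in> F \<inter> square a \<Longrightarrow> u x \<noteq> 0"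
    by (rule not_connects_signed_function[OF F compact_square closed_coordinate_line
      closed_coordinate_line disj no(1)]) (rule that)
  obtain v where v: "continuous_on UNIV v"
    "\<And>x. x \<in> {x. x $ 2 = -a} \<inter> square a \<Longrightarrow> v x < (0::real)"
    "\<And>x. x \<in> {x. x $ 2 = a} \<inter> square a \<Longrightarrow> v x > 0" "\<And>x. x \<in> G \<inter> square a \<Longrightarrow> v x \<noteq> 0"
    by (rule not_connects_signed_function[OF G compact_square closed_coordinate_line
      closed_coordinate_line disj no(2)]) (rule that)
  obtain x where "x \<in> square a" "u x = 0" "v x = 0"
    by (rule poincare_miranda_square[OF a u(1) v(1)]) (use u(2,3) v(2,3) in auto)
  then show False using u(4)[of x] v(4)[of x] FG by blast
qed

text \<open>A convex piece that touches the path component of x lies inside it. The pieces that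
  touch it and those that do not thus have disjoint unions, both closed by finiteness, and a
  connected \<open>C\<close> cannot meet both. This turns a connecting set into a path through
  Voronoi cells.\<close>

lemma path_component_finite_Union_convex:
  fixes \<C> :: "'a::real_normed_vector set set"
  assumes fin: "finite \<C>" and conv: "\<And>c. c \<in> \<C> \<Longrightarrow> convex c" and cl: "\<And>c. c \<in> \<C> \<Longrightarrow> closed c"
    and C: "connected C" "C \<subseteq> \<Union>\<C>" and xy: "x \<in> C" "y \<in> C"
  shows "path_component (\<Union>\<C>) x y"
proof -
  define A where "A = path_component_set (\<Union>\<C>) x"
  define P where "P = {c \<in> \<C>. c \<inter> A \<noteq> {}}"
  have "c \<subseteq> A" if c: "c \<in> P" for c
  proof -
    from c obtain z where z: "z \<in> c" "z \<in> A" and cC: "c \<in> \<C>" by (auto simp: P_def)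
    have "path_component (\<Union>\<C>) z w" if "w \<in> c" for w
      using convex_imp_path_connected[OF conv[OF cC]] z(1) that cC
      by (meson Union_upper path_component_of_subset path_connected_component)
    with z(2) show ?thesis unfolding A_def using path_component_trans by blast
  qed
  then have PA: "\<Union>P \<subseteq> A" by blast
  have disj: "A \<inter> \<Union>(\<C> - P) = {}" by (auto simp: P_def)
  have c1: "closed (\<Union>P)" "closed (\<Union>(\<C> - P))" using fin cl by (auto simp: P_def intro!: closed_Union)
  have xA: "x \<in> A" using C(2) xy(1) by (auto simp: A_def path_component_refl_eq)
  have AP: "z \<in> \<Union>P" if "z \<in> A" "z \<in> C" for z
    using that C(2) by (auto simp: P_def)
  have "y \<in> A"
  proof (rule ccontr)
    assume "y \<notin> A"
    then have "y \<in> \<Union>(\<C> - P)" using C(2) xy(2) PA by blast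
    moreover have "C \<subseteq> \<Union>P \<union> \<Union>(\<C> - P)" using C(2) by blast
    moreover have "\<Union>P \<inter> \<Union>(\<C> - P) \<inter> C = {}" using PA disj by blast
    moreover have "x \<in> \<Union>P" using AP xA xy(1) by blast
    ultimately show False using connected_closedD[OF C(1), of "\<Union>P" "\<Union>(\<C> - P)"] c1 xy by blast
  qed
  then show ?thesis by (simp add: A_def)
qed

subsection \<open>The space of coloured configurations\<close>

text \<open>The pair of the sets of points whose cells are white and black, respectively.\<close>

type_synonym config = "(real^2) set \<times> (real^2) set"

definition void_event :: "(real^2) set \<Rightarrow> (real^2) set \<Rightarrow> config set" where
  "void_event A A' = {c. fst c \<inter> A = {} \<and> snd c \<inter> A' = {}}"

text \<open>The sets have finite area because \<open>poisson_process\<close> prescribes the counts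
  only there; moreover \<open>measure\<close> is 0 on sets of infinite measure, which would falsify
  the exponential formula.\<close>

definition void_events :: "config set set" where
  "void_events = {void_event A A' | A A'. A \<in> fmeasurable lborel \<and> A' \<in> fmeasurable lborel}"

definition config_space :: "config measure" where
  "config_space = sigma UNIV void_events"

lemma space_config_space [simp]: "space config_space = UNIV"
  by (simp add: config_space_def)

lemma UNIV_in_sets_config_space [simp]: "UNIV \<in> sets config_space"
  using sets.top[of config_space] by simp

lemma sets_config_space: "sets config_space = sigma_sets UNIV void_events"
  by (simp add: config_space_def)

lemma void_event_Int: "void_event A A' \<inter> void_event C C' = void_event (A \<union> C) (A' \<union> C')"
  by (auto simp: void_event_def)

lemma void_event_empty: "void_event {} {} = UNIV"
  by (simp add: void_event_def)

lemma void_event_in_sets: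
  "A \<in> fmeasurable lborel \<Longrightarrow> A' \<in> fmeasurable lborel \<Longrightarrow> void_event A A' \<in> sets config_space"
  unfolding sets_config_space void_events_def by (rule sigma_sets.Basic) blast

lemma Int_stable_void_events: "Int_stable void_events"
  unfolding Int_stable_def
proof (intro ballI)
  fix a b assume "a \<in> void_events" "b \<in> void_events"
  then obtain A A' C C' where a: "a = void_event A A'" "A \<in> fmeasurable lborel" "A' \<in> fmeasurable lborel"
    and b: "b = void_event C C'" "C \<in> fmeasurable lborel" "C' \<in> fmeasurable lborel"
    unfolding void_events_def by blast
  have "a \<inter> b = void_event (A \<union> C) (A' \<union> C')" by (simp add: a(1) b(1) void_event_Int)
  then show "a \<inter> b \<in> void_events"
    using a b unfolding void_events_def by (blast intro: fmeasurable.Un)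
qed

lemma measurable_into_config_space:
  assumes "\<And>A A'. A \<in> fmeasurable lborel \<Longrightarrow> A' \<in> fmeasurable lborel \<Longrightarrow>
      {\<omega> \<in> space M. f \<omega> \<in> void_event A A'} \<in> sets M"
  shows "f \<in> measurable M config_space"
  unfolding config_space_def
proof (rule measurable_measure_of)
  fix E assume "E \<in> void_events"
  then obtain A A' where E: "E = void_event A A'" "A \<in> fmeasurable lborel" "A' \<in> fmeasurable lborel"
    unfolding void_events_def by blast
  have "f -` E \<inter> space M = {\<omega> \<in> space M. f \<omega> \<in> void_event A A'}" by (auto simp: E(1))
  then show "f -` E \<inter> space M \<in> sets M" using assms E(2,3) by simp
qed auto

text \<open>Void events are closed under intersection and generate the sigma-algebra, so the
  uniqueness theorem for measures applies; \<open>void_event {} {}\<close> is the whole space and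
  provides the exhausting sequence.\<close>

lemma distr_config_space_eqI:
  assumes M: "prob_space M" and f: "f \<in> measurable M config_space" and g: "g \<in> measurable M config_space"
    and eq: "\<And>A A'. A \<in> fmeasurable lborel \<Longrightarrow> A' \<in> fmeasurable lborel \<Longrightarrow>
      measure M {\<omega> \<in> space M. f \<omega> \<in> void_event A A'} = measure M {\<omega> \<in> space M. g \<omega> \<in> void_event A A'}"
  shows "distr M config_space f = distr M config_space g"
proof (rule measure_eqI_generator_eq[OF Int_stable_void_events, of UNIV _ _ "\<lambda>_. void_event {} {}"])
  interpret prob_space M by (fact M)
  show "emeasure (distr M config_space f) E = emeasure (distr M config_space g) E" if "E \<in> void_events" for E
  proof -
    from that obtain A A' where E: "E = void_event A A'" "A \<in> fmeasurable lborel" "A' \<in> fmeasurable lborel"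
      unfolding void_events_def by blast
    have *: "h -` E \<inter> space M = {\<omega> \<in> space M. h \<omega> \<in> void_event A A'}" for h by (auto simp: E(1))
    show ?thesis
      using void_event_in_sets[OF E(2,3)] f g eq[OF E(2,3)]
      by (subst (1 2) emeasure_distr) (simp_all add: E(1) emeasure_eq_measure *[unfolded E(1)])
  qed
  show "emeasure (distr M config_space f) (void_event {} {}) \<noteq> \<infinity>" for i :: nat
    using finite_measure.emeasure_finite[OF prob_space.finite_measure[OF prob_space_distr[OF f]]] by simp
  show "range (\<lambda>_::nat. void_event {} {}) \<subseteq> void_events" unfolding void_events_def by auto
qed (auto simp: sets_config_space void_event_empty)

section \<open>Measurability of the white region and of connection events\<close>

lemma ball_fmeasurable: "ball (z::real^2) r \<in> fmeasurable lborel"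
  by (intro fmeasurableI emeasure_lborel_ball_finite) simp

lemma measurable_hits_fst: "A \<in> fmeasurable lborel \<Longrightarrow> {c. fst c \<inter> A = {}} \<in> sets config_space"
  using void_event_in_sets[of A "{}"] by (simp add: void_event_def)

lemma measurable_hits_snd: "A \<in> fmeasurable lborel \<Longrightarrow> {c. snd c \<inter> A = {}} \<in> sets config_space"
  using void_event_in_sets[of "{}" A] by (simp add: void_event_def)

lemma infdist_less_iff: "A \<noteq> {} \<Longrightarrow> infdist x A < r \<longleftrightarrow> A \<inter> ball x r \<noteq> {}"
  by (subst infdist_notempty) (auto simp: cInf_less_iff)

text \<open>The distance to a nonempty set is below \<open>a\<close> exactly when the set hits an
  open ball of radius \<open>a\<close>, which is the complement of a void event.\<close>

lemma borel_measurable_infdist_config: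
  fixes p :: "config \<Rightarrow> (real^2) set"
  assumes hits: "\<And>z r. {c. p c \<inter> ball z r = {}} \<in> sets config_space"
  shows "{c. p c = {}} \<in> sets config_space"
    and "(\<lambda>c. infdist z (p c)) \<in> borel_measurable config_space"
proof -
  have "{c. p c = {}} = (\<Inter>n::nat. {c. p c \<inter> ball 0 (real n) = {}})"
    by (auto simp: disjoint_iff) (metis reals_Archimedean2)
  then show empty: "{c. p c = {}} \<in> sets config_space" using hits by auto
  show "(\<lambda>c. infdist z (p c)) \<in> borel_measurable config_space"
    unfolding borel_measurable_iff_less
  proof
    fix a
    show "{w \<in> space config_space. infdist z (p w) < a} \<in> sets config_space"
    proof (cases "a \<le> 0")
      case True
      then have "\<not> infdist z (p w) < a" for w
        using infdist_nonneg[of z "p w"] by linarith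
      then show ?thesis by (simp only: simp_thms Collect_empty_eq[THEN iffD2] sets.empty_sets)
    next
      case False
      then have "{w \<in> space config_space. infdist z (p w) < a} =
          {c. p c = {}} \<union> (space config_space - {c. p c \<inter> ball z a = {}})"
      proof (intro set_eqI)
        fix c
        show "c \<in> {w \<in> space config_space. infdist z (p w) < a} \<longleftrightarrow>
            c \<in> {c. p c = {}} \<union> (space config_space - {c. p c \<inter> ball z a = {}})"
          using infdist_less_iff[of "p c" z a] False by (cases "p c = {}") (simp_all add: infdist_def)
      qed
      then show ?thesis using sets.Un[OF empty sets.compl_sets[OF hits[of z a]]] by simp
    qed
  qed
qed

lemmas borel_measurable_infdist_fst [measurable] =
  borel_measurable_infdist_config(2)[of fst, OF measurable_hits_fst[OF ball_fmeasurable]]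
lemmas borel_measurable_infdist_snd [measurable] =
  borel_measurable_infdist_config(2)[of snd, OF measurable_hits_snd[OF ball_fmeasurable]]

text \<open>\<open>infdist y {} = 0\<close>: this is the union of the white cells only if both colours occur.\<close>

definition white_region :: "config \<Rightarrow> (real^2) set" where
  "white_region c = {y. infdist y (fst c) \<le> infdist y (snd c)}"

definition connect_event :: "(real^2) set \<Rightarrow> (real^2) set \<Rightarrow> (real^2) set \<Rightarrow> config set" where
  "connect_event K S T = {c. connects (white_region c) K S T}"

lemma closed_white_region: "closed (white_region c)"
  unfolding white_region_def by (intro closed_Collect_le continuous_intros)

text \<open>On a compact \<open>Z\<close>, avoidance gives the difference of the two distances a
  positive minimum. A uniform gap is a closed condition in z, so it can be tested on a countable
  dense subset of \<open>Z\<close>.\<close>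

lemma white_region_avoids_measurable:
  assumes Z: "compact Z"
  shows "{c. white_region c \<inter> Z = {}} \<in> sets config_space"
proof (cases "Z = {}")
  case False
  obtain D where D: "countable D" "D \<subseteq> Z" "Z \<subseteq> closure D" by (rule separable)
  have "{c. white_region c \<inter> Z = {}} =
    (\<Union>n::nat. \<Inter>z\<in>D. {c \<in> space config_space. infdist z (snd c) + 1 / real (Suc n) \<le> infdist z (fst c)})"
  proof (intro set_eqI iffI)
    fix c :: config assume "c \<in> {c. white_region c \<inter> Z = {}}"
    then have pos: "infdist z (fst c) - infdist z (snd c) > 0" if "z \<in> Z" for z
      using that by (force simp: white_region_def)
    obtain x where x: "x \<in> Z" "\<And>y. y \<in> Z \<Longrightarrow>
        infdist x (fst c) - infdist x (snd c) \<le> infdist y (fst c) - infdist y (snd c)"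
      using continuous_attains_inf[OF Z False, of "\<lambda>z. infdist z (fst c) - infdist z (snd c)"]
        continuous_on_diff[OF continuous_on_infdist continuous_on_infdist, OF continuous_on_id continuous_on_id]
      by blast
    obtain n where n: "1 / real (Suc n) < infdist x (fst c) - infdist x (snd c)"
      using nat_approx_posE[OF pos[OF x(1)]] by auto
    have "\<forall>z\<in>D. infdist z (snd c) + 1 / real (Suc n) \<le> infdist z (fst c)"
    proof
      fix z assume "z \<in> D"
      then have "infdist x (fst c) - infdist x (snd c) \<le> infdist z (fst c) - infdist z (snd c)"
        using x(2) D(2) by blast
      with n show "infdist z (snd c) + 1 / real (Suc n) \<le> infdist z (fst c)" by linarith
    qed
    then show "c \<in> (\<Union>n::nat. \<Inter>z\<in>D. {c \<in> space config_space.
        infdist z (snd c) + 1 / real (Suc n) \<le> infdist z (fst c)})" by auto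
  next
    fix c :: config assume "c \<in> (\<Union>n::nat. \<Inter>z\<in>D. {c \<in> space config_space.
        infdist z (snd c) + 1 / real (Suc n) \<le> infdist z (fst c)})"
    then obtain n where n: "D \<subseteq> {z. infdist z (snd c) + 1 / real (Suc n) \<le> infdist z (fst c)}" by auto
    have "closed {z. infdist z (snd c) + 1 / real (Suc n) \<le> infdist z (fst c)}"
      by (intro closed_Collect_le continuous_intros)
    with n D(3) have "Z \<subseteq> {z. infdist z (snd c) + 1 / real (Suc n) \<le> infdist z (fst c)}"
      by (meson closure_minimal order_trans)
    moreover have "0 < 1 / real (Suc n)" by simp
    ultimately have "infdist z (snd c) < infdist z (fst c)" if "z \<in> Z" for z
      using that by (metis (mono_tags) subsetD mem_Collect_eq less_add_same_cancel1 order_less_le_trans)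
    then show "c \<in> {c. white_region c \<inter> Z = {}}"
      unfolding white_region_def by (fastforce simp: not_less[symmetric])
  qed
  moreover have "D \<noteq> {}" using D(3) False by auto
  moreover have "{c \<in> space config_space. infdist z (snd c) + 1 / real (Suc n) \<le> infdist z (fst c)}
      \<in> sets config_space" for z n
    by measurable
  ultimately show ?thesis
    using D(1) by (simp only:) (intro sets.countable_UN'' sets.countable_INT'' countableI_type, auto)
qed (use sets.top[of config_space] in simp)

lemma connect_event_measurable:
  assumes K: "compact K" and S: "closed S" and T: "closed T"
  shows "connect_event K S T \<in> sets config_space"
proof -
  obtain \<B> :: "(real^2) set set" where B: "countable \<B>" "topological_basis \<B>"
    using ex_countable_basis by blast
  let ?I = "{\<U>. finite \<U> \<and> \<U> \<subseteq> \<B>}"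
  have "compact (barrier K S T U)" if "open U" for U
    unfolding barrier_def using K S T that by (intro compact_Int_closed) auto
  then have "compact (barrier K S T (\<Union>\<U>))" if "\<U> \<subseteq> \<B>" for \<U>
    using B(2) that topological_basis_open by blast
  then have "(\<Union>\<U>\<in>?I. {c. white_region c \<inter> barrier K S T (\<Union>\<U>) = {}}) \<in> sets config_space"
    using countable_Collect_finite_subset[OF B(1)]
    by (intro sets.countable_UN'' white_region_avoids_measurable) simp_all
  moreover have "connect_event K S T =
      space config_space - (\<Union>\<U>\<in>?I. {c. white_region c \<inter> barrier K S T (\<Union>\<U>) = {}})"
  proof (intro set_eqI)
    fix c
    show "c \<in> connect_event K S T \<longleftrightarrow>
        c \<in> space config_space - (\<Union>\<U>\<in>?I. {c. white_region c \<inter> barrier K S T (\<Union>\<U>) = {}})"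
      using not_connects_iff_barrier[OF B(2) closed_white_region K S T, of c]
      by (simp add: connect_event_def) metis
  qed
  ultimately show ?thesis by (simp only: sets.compl_sets)
qed

section \<open>Isometries acting on configurations\<close>

lemma infdist_isometry_image:
  assumes "\<And>x y. dist (f x) (f y) = dist x y"
  shows "infdist (f x) (f ` A) = infdist x A"
  using assms by (simp add: infdist_def image_image)

lemma white_region_isometry:
  assumes f: "\<And>x y. dist (f x) (f y) = dist x y"
  shows "f ` white_region c \<subseteq> white_region (map_prod (image f) (image f) c)"
  by (auto simp: white_region_def infdist_isometry_image[OF f])

lemma connect_event_isometry:
  assumes f: "\<And>x y. dist (f x) (f y) = dist x y" and c: "c \<in> connect_event K S T"
    and sub: "f ` K \<subseteq> K'" "f ` S \<subseteq> S'" "f ` T \<subseteq> T'"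
  shows "map_prod (image f) (image f) c \<in> connect_event K' S' T'"
proof -
  have "continuous_on UNIV f"
    unfolding continuous_on_iff f by blast
  then have "connects (f ` white_region c) (f ` K) (f ` S) (f ` T)"
    using c connects_image unfolding connect_event_def by blast
  then show ?thesis
    using connects_mono[OF _ white_region_isometry[of f c, OF f] sub]
    by (simp add: connect_event_def)
qed

subsection \<open>Void probabilities\<close>

text \<open>The count is the counting measure of a set of indices, so repeated points count with
  multiplicity and a finite value forces finitely many indices.\<close>

lemma point_count_eq_of_nat_iff:
  "point_count X A \<omega> = of_nat k \<longleftrightarrow> finite {n. X n \<omega> \<in> A} \<and> card {n. X n \<omega> \<in> A} = k"
proof -
  have "point_count X A \<omega> = (\<integral>\<^sup>+n. indicator {n. X n \<omega> \<in> A} n \<partial>count_space UNIV)"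
    unfolding point_count_def nn_integral_count_space_nat[symmetric]
    by (intro nn_integral_cong) (simp add: indicator_def)
  also have "\<dots> = emeasure (count_space UNIV) {n. X n \<omega> \<in> A}"
    by (rule nn_integral_indicator) simp
  finally have eq: "point_count X A \<omega> = emeasure (count_space UNIV) {n. X n \<omega> \<in> A}" .
  show ?thesis
    by (cases "finite {n. X n \<omega> \<in> A}") (auto simp: eq emeasure_count_space_finite)
qed

lemma countable_finite_pairs:
  "countable {(K :: nat set, L :: nat set). finite K \<and> finite L \<and> P K L}"
proof (rule countable_subset)
  show "{(K :: nat set, L :: nat set). finite K \<and> finite L \<and> P K L} \<subseteq> Collect finite \<times> Collect finite"
    by auto
qed (intro countable_SIGMA countable_Collect_finite)

lemma exp_sums: "(\<lambda>k. x ^ k / fact k) sums exp (x::real)"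
  using exp_converges[of x] by (simp add: divide_inverse mult.commute)

locale critical_voronoi = voronoi_percolation M "1/2" X B
  for M :: "'w measure" and X :: "nat \<Rightarrow> 'w \<Rightarrow> real^2" and B :: "nat \<Rightarrow> 'w \<Rightarrow> bool"
begin

definition configuration :: "'w \<Rightarrow> config" where
  "configuration \<omega> = ((\<lambda>n. X n \<omega>) ` {n. \<not> B n \<omega>}, (\<lambda>n. X n \<omega>) ` {n. B n \<omega>})"

lemma configuration_in_void_event_iff:
  "configuration \<omega> \<in> void_event A A' \<longleftrightarrow> (\<forall>n. (X n \<omega> \<in> A \<longrightarrow> B n \<omega>) \<and> (X n \<omega> \<in> A' \<longrightarrow> \<not> B n \<omega>))"
  by (auto simp: configuration_def void_event_def)

lemma measurable_X [measurable]: "X n \<in> measurable M borel"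
  using poisson by (simp add: poisson_process_def)

lemma measurable_B [measurable]: "Measurable.pred M (B n)"
  using black_indep by (simp add: indep_vars_def)

lemma measurable_configuration [measurable]: "configuration \<in> measurable M config_space"
proof (rule measurable_into_config_space)
  fix A A' :: "(real^2) set" assume "A \<in> fmeasurable lborel" "A' \<in> fmeasurable lborel"
  then have [measurable]: "A \<in> sets borel" "A' \<in> sets borel" by (auto dest: fmeasurableD)
  show "{\<omega> \<in> space M. configuration \<omega> \<in> void_event A A'} \<in> sets M"
    unfolding configuration_in_void_event_iff by measurable
qed

lemma prob_colours:
  assumes "finite K" "finite L" "K \<inter> L = {}"
  shows "prob {\<omega> \<in> space M. (\<forall>n\<in>K. B n \<omega>) \<and> (\<forall>n\<in>L. \<not> B n \<omega>)} = (1/2) ^ (card K + card L)"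
\<comment> \<open>\<open>indep_varsD\<close> requires a nonempty index set.\<close>
proof (cases "K \<union> L = {}")
  case True
  then show ?thesis by (simp add: prob_space)
next
  case False
  let ?A = "\<lambda>n. if n \<in> K then {True} else {False}"
  have "{\<omega> \<in> space M. (\<forall>n\<in>K. B n \<omega>) \<and> (\<forall>n\<in>L. \<not> B n \<omega>)} = (\<Inter>n\<in>K \<union> L. B n -` ?A n \<inter> space M)"
  proof (intro set_eqI)
    fix \<omega>
    have "(\<forall>n\<in>K. B n \<omega>) \<and> (\<forall>n\<in>L. \<not> B n \<omega>) \<longleftrightarrow> (\<forall>n\<in>K \<union> L. B n \<omega> \<in> ?A n)"
      using assms(3) by auto
    then show "\<omega> \<in> {\<omega> \<in> space M. (\<forall>n\<in>K. B n \<omega>) \<and> (\<forall>n\<in>L. \<not> B n \<omega>)} \<longleftrightarrow>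
        \<omega> \<in> (\<Inter>n\<in>K \<union> L. B n -` ?A n \<inter> space M)"
      using False by blast
  qed
  also have "prob \<dots> = (\<Prod>n\<in>K \<union> L. prob (B n -` ?A n \<inter> space M))"
    by (rule indep_varsD[OF black_indep False]) (use assms in auto)
  also have "\<dots> = (\<Prod>n\<in>K \<union> L. 1/2)"
  proof (rule prod.cong[OF refl])
    fix n
    have "B n -` {True} \<inter> space M = {\<omega> \<in> space M. B n \<omega>}"
      "B n -` {False} \<inter> space M = {\<omega> \<in> space M. \<not> B n \<omega>}" by auto
    moreover have "prob {\<omega> \<in> space M. \<not> B n \<omega>} = 1/2"
      using prob_neg[of "B n"] black_prob[of n] by simp
    ultimately show "prob (B n -` ?A n \<inter> space M) = 1/2" using black_prob[of n] by simp
  qed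
  also have "\<dots> = (1/2) ^ (card K + card L)"
    using assms by (simp add: card_Un_disjoint)
  finally show ?thesis .
qed

text \<open>Once \<open>K\<close> and \<open>L\<close> are fixed, \<open>G\<close> depends on the
  points alone and the colour condition on the colours alone. Independence of the two sigma-algebras
  can then be used, although the indices falling in a region are random.\<close>

lemma prob_indices_colours:
  assumes E: "E \<in> sets borel" "E' \<in> sets borel" "C \<in> sets borel"
    and KL: "finite K" "finite L" "K \<inter> L = {}"
  defines "G \<equiv> {\<omega> \<in> space M. {n. X n \<omega> \<in> E} = K \<and> {n. X n \<omega> \<in> E'} = L \<and> (\<forall>n. X n \<omega> \<notin> C)}"
  shows "G \<in> sets M"
    and "prob (G \<inter> {\<omega> \<in> space M. (\<forall>n\<in>K. B n \<omega>) \<and> (\<forall>n\<in>L. \<not> B n \<omega>)}) = prob G * (1/2) ^ (card K + card L)"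
proof -
  note E[measurable]
  let ?PX = "\<Pi>\<^sub>M n\<in>(UNIV::nat set). (borel :: (real^2) measure)"
  let ?PB = "\<Pi>\<^sub>M n\<in>(UNIV::nat set). count_space (UNIV::bool set)"
  let ?G = "{x \<in> space ?PX. \<forall>n. (x n \<in> E \<longleftrightarrow> n \<in> K) \<and> (x n \<in> E' \<longleftrightarrow> n \<in> L) \<and> x n \<notin> C}"
  let ?H = "{b \<in> space ?PB. \<forall>n. (n \<in> K \<longrightarrow> b n) \<and> (n \<in> L \<longrightarrow> \<not> b n)}"
  let ?H' = "{\<omega> \<in> space M. (\<forall>n\<in>K. B n \<omega>) \<and> (\<forall>n\<in>L. \<not> B n \<omega>)}"
  have G_eq: "G = (\<lambda>\<omega> n. X n \<omega>) -` ?G \<inter> space M"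
    unfolding G_def by (auto simp: space_PiM set_eq_iff)
  have H_eq: "?H' = (\<lambda>\<omega> n. B n \<omega>) -` ?H \<inter> space M"
    by (auto simp: space_PiM)
  have "?G \<in> sets ?PX" by measurable
  then have 1: "G \<in> sets (vimage_algebra (space M) (\<lambda>\<omega> n. X n \<omega>) ?PX)"
    unfolding G_eq by (rule in_vimage_algebra)
  have "?H \<in> sets ?PB" by measurable
  then have 2: "?H' \<in> sets (vimage_algebra (space M) (\<lambda>\<omega> n. B n \<omega>) ?PB)"
    unfolding H_eq by (rule in_vimage_algebra)
  show "prob (G \<inter> ?H') = prob G * (1/2) ^ (card K + card L)"
    using indep_setD[OF black_indep_points 1 2] prob_colours[OF KL] by simp
  have "{\<omega> \<in> space M. \<forall>n. (X n \<omega> \<in> E \<longleftrightarrow> n \<in> K) \<and> (X n \<omega> \<in> E' \<longleftrightarrow> n \<in> L) \<and> X n \<omega> \<notin> C} \<in> sets M"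
    by measurable
  also have "{\<omega> \<in> space M. \<forall>n. (X n \<omega> \<in> E \<longleftrightarrow> n \<in> K) \<and> (X n \<omega> \<in> E' \<longleftrightarrow> n \<in> L) \<and> X n \<omega> \<notin> C} = G"
    unfolding G_def by (auto simp: set_eq_iff)
  finally show "G \<in> sets M" .
qed

lemma prob_point_count:
  assumes "A \<in> fmeasurable lborel"
  shows "prob {\<omega> \<in> space M. point_count X A \<omega> = of_nat k} =
    exp (- measure lborel A) * measure lborel A ^ k / fact k"
proof -
  have "A \<in> sets lborel" "emeasure lborel A < \<infinity>"
    using fmeasurableD[OF assms] fmeasurableD2[OF assms] by (simp_all add: less_top)
  then show ?thesis
    using poisson unfolding poisson_process_def by blast
qed

lemma measurable_point_count [measurable]:
  assumes [measurable]: "A \<in> sets borel"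
  shows "point_count X A \<in> borel_measurable M"
  unfolding point_count_def by measurable

lemma prob_point_count2:
  assumes A: "A \<in> sets borel" and C: "C \<in> sets borel" and disj: "A \<inter> C = {}"
  shows "prob {\<omega> \<in> space M. point_count X A \<omega> = of_nat k \<and> point_count X C \<omega> = of_nat l} =
    prob {\<omega> \<in> space M. point_count X A \<omega> = of_nat k} * prob {\<omega> \<in> space M. point_count X C \<omega> = of_nat l}"
proof -
  let ?A = "\<lambda>i::nat. if i = 0 then A else C"
  let ?k = "\<lambda>i::nat. {of_nat (if i = 0 then k else l)} :: ennreal set"
  have lt2: "{..<2} = {0, 1::nat}" by auto
  have "?A ` {..<2} \<subseteq> sets lborel" "disjoint_family_on ?A {..<2}"
    using A C disj by (auto simp: lt2 disjoint_family_on_def)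
  then have "indep_vars (\<lambda>_. borel) (\<lambda>i. point_count X (?A i)) {..<2}"
    using poisson unfolding poisson_process_def by blast
  then have "prob (\<Inter>i\<in>{..<2}. point_count X (?A i) -` ?k i \<inter> space M)
      = (\<Prod>i\<in>{..<2}. prob (point_count X (?A i) -` ?k i \<inter> space M))"
    by (rule indep_varsD) (auto simp: lt2)
  moreover have "point_count X D -` {c} \<inter> space M = {\<omega> \<in> space M. point_count X D \<omega> = c}" for D c
    by auto
  moreover have "{\<omega> \<in> space M. point_count X A \<omega> = of_nat k} \<inter> {\<omega> \<in> space M. point_count X C \<omega> = of_nat l}
      = {\<omega> \<in> space M. point_count X A \<omega> = of_nat k \<and> point_count X C \<omega> = of_nat l}" by auto
  ultimately show ?thesis by (simp add: lt2)
qed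

text \<open>The Poisson weights over all natural numbers already sum to 1, leaving no mass for an
  infinite count.\<close>

lemma AE_finite_points:
  assumes A: "A \<in> fmeasurable lborel"
  shows "AE \<omega> in M. finite {n. X n \<omega> \<in> A}"
proof -
  have [measurable]: "A \<in> sets borel" using fmeasurableD[OF A] by simp
  let ?N = "\<lambda>k::nat. {\<omega> \<in> space M. point_count X A \<omega> = of_nat k}"
  have "(\<lambda>k. prob (?N k)) sums prob (\<Union>k. ?N k)"
    by (rule finite_measure_UNION) (auto simp: disjoint_family_on_def)
  moreover have "(\<lambda>k. prob (?N k)) sums (exp (- measure lborel A) * exp (measure lborel A))"
    using sums_mult[OF exp_sums] by (simp add: prob_point_count[OF A])
  ultimately have "prob (\<Union>k. ?N k) = 1"
    by (simp add: sums_iff flip: exp_add)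
  then have "AE \<omega> in M. \<omega> \<in> (\<Union>k. ?N k)" by (rule AE_prob_1)
  then show ?thesis by (rule eventually_mono) (auto simp: point_count_eq_of_nat_iff)
qed

text \<open>A point of \<open>A\<close> must be black and a point of \<open>A'\<close> white. Hence
  \<open>A \<inter> A'\<close> must contain no point, while each of the \<open>k\<close> points in
  the symmetric difference \<open>F\<close> has one prescribed colour, at cost 1/2. The event is
  split over the countably many pairs of index sets that \<open>A - A'\<close> and
  \<open>A' - A\<close> can receive.\<close>

lemma prob_void_event_count:
  assumes A: "A \<in> fmeasurable lborel" "A' \<in> fmeasurable lborel"
  defines "F \<equiv> (A - A') \<union> (A' - A)"
  shows "prob {\<omega> \<in> space M. configuration \<omega> \<in> void_event A A' \<and> point_count X F \<omega> = of_nat k} =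
    (1/2) ^ k * prob {\<omega> \<in> space M. point_count X F \<omega> = of_nat k \<and> point_count X (A \<inter> A') \<omega> = of_nat 0}"
proof -
  have [measurable]: "A \<in> sets borel" "A' \<in> sets borel" using A by (auto dest: fmeasurableD)
  define I where "I = {(K::nat set, L::nat set). finite K \<and> finite L \<and> K \<inter> L = {} \<and> card K + card L = k}"
  define G where "G = (\<lambda>(K, L). {\<omega> \<in> space M. {n. X n \<omega> \<in> A - A'} = K \<and> {n. X n \<omega> \<in> A' - A} = L \<and>
    (\<forall>n. X n \<omega> \<notin> A \<inter> A')})"
  define H where "H = (\<lambda>(K, L). {\<omega> \<in> space M. (\<forall>n\<in>K. B n \<omega>) \<and> (\<forall>n\<in>L. \<not> B n \<omega>)})"
  have I: "countable I" unfolding I_def by (rule countable_finite_pairs)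
  have G: "G i \<in> sets M" and H: "H i \<in> sets M"
    and GH: "prob (G i \<inter> H i) = (1/2) ^ k * prob (G i)" if "i \<in> I" for i
    using that prob_indices_colours[of "A - A'" "A' - A" "A \<inter> A'" "fst i" "snd i"]
    by (auto simp: I_def G_def H_def)
  have split_indices: "{n. X n \<omega> \<in> F} = {n. X n \<omega> \<in> A - A'} \<union> {n. X n \<omega> \<in> A' - A}"
    "{n. X n \<omega> \<in> A - A'} \<inter> {n. X n \<omega> \<in> A' - A} = {}" for \<omega>
    by (auto simp: F_def)
  have count_iff: "point_count X F \<omega> = of_nat k \<longleftrightarrow> ({n. X n \<omega> \<in> A - A'}, {n. X n \<omega> \<in> A' - A}) \<in> I" for \<omega>
    unfolding point_count_eq_of_nat_iff split_indices(1) I_def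
    using split_indices(2)[of \<omega>] by (auto simp: card_Un_disjoint)
  have C0: "point_count X (A \<inter> A') \<omega> = of_nat 0 \<longleftrightarrow> (\<forall>n. X n \<omega> \<notin> A \<inter> A')" for \<omega>
    unfolding point_count_eq_of_nat_iff by (metis (mono_tags) Collect_empty_eq card_0_eq card.empty finite.emptyI)
  have disj: "disjoint_family_on G I"
    unfolding disjoint_family_on_def by (auto simp: G_def)
  then have disj': "disjoint_family_on (\<lambda>i. G i \<inter> H i) I"
    unfolding disjoint_family_on_def by blast
  have eq1: "{\<omega> \<in> space M. point_count X F \<omega> = of_nat k \<and> point_count X (A \<inter> A') \<omega> = of_nat 0} = (\<Union>i\<in>I. G i)"
  proof (intro set_eqI)
    fix \<omega>
    let ?i = "({n. X n \<omega> \<in> A - A'}, {n. X n \<omega> \<in> A' - A})"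
    have "\<omega> \<in> G i \<longleftrightarrow> i = ?i \<and> \<omega> \<in> space M \<and> (\<forall>n. X n \<omega> \<notin> A \<inter> A')" for i
      by (cases i) (simp add: G_def, blast)
    then show "\<omega> \<in> {\<omega> \<in> space M. point_count X F \<omega> = of_nat k \<and>
        point_count X (A \<inter> A') \<omega> = of_nat 0} \<longleftrightarrow> \<omega> \<in> (\<Union>i\<in>I. G i)"
      unfolding count_iff C0 UN_iff mem_Collect_eq by metis
  qed
  have eq2: "{\<omega> \<in> space M. configuration \<omega> \<in> void_event A A' \<and> point_count X F \<omega> = of_nat k} =
      (\<Union>i\<in>I. G i \<inter> H i)"
  proof (intro set_eqI)
    fix \<omega>
    let ?i = "({n. X n \<omega> \<in> A - A'}, {n. X n \<omega> \<in> A' - A})"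
    have "\<omega> \<in> G i \<inter> H i \<longleftrightarrow> i = ?i \<and> \<omega> \<in> G ?i \<inter> H ?i" for i
      by (cases i) (simp add: G_def, blast)
    moreover have "\<omega> \<in> G ?i \<inter> H ?i \<longleftrightarrow> \<omega> \<in> space M \<and> configuration \<omega> \<in> void_event A A'"
      unfolding configuration_in_void_event_iff G_def H_def by auto
    ultimately show "\<omega> \<in> {\<omega> \<in> space M. configuration \<omega> \<in> void_event A A' \<and> point_count X F \<omega> = of_nat k} \<longleftrightarrow>
        \<omega> \<in> (\<Union>i\<in>I. G i \<inter> H i)"
      unfolding count_iff UN_iff mem_Collect_eq by metis
  qed
  have "emeasure M (\<Union>i\<in>I. G i \<inter> H i) = (\<integral>\<^sup>+i. emeasure M (G i \<inter> H i) \<partial>count_space I)"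
    using G H by (intro emeasure_UN_countable I disj') auto
  also have "\<dots> = (\<integral>\<^sup>+i. ennreal ((1/2) ^ k) * emeasure M (G i) \<partial>count_space I)"
    by (intro nn_integral_cong) (simp add: emeasure_eq_measure GH ennreal_mult)
  also have "\<dots> = ennreal ((1/2) ^ k) * (\<integral>\<^sup>+i. emeasure M (G i) \<partial>count_space I)"
    by (rule nn_integral_cmult) simp
  also have "(\<integral>\<^sup>+i. emeasure M (G i) \<partial>count_space I) = emeasure M (\<Union>i\<in>I. G i)"
    using G by (intro emeasure_UN_countable[symmetric] I disj) auto
  finally have "ennreal (prob (\<Union>i\<in>I. G i \<inter> H i)) = ennreal ((1/2) ^ k * prob (\<Union>i\<in>I. G i))"
    by (simp add: emeasure_eq_measure ennreal_mult)
  then show ?thesis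
    unfolding eq1 eq2 by (simp del: ennreal_half)
qed

text \<open>With f and c the areas of \<open>F\<close> and \<open>A \<inter> A'\<close>, whose
  counts are independent, summing exp(-f-c) (f/2)^k / k! over k gives exp(-f/2-c), and f + 2c is the
  sum of the areas of \<open>A\<close> and \<open>A'\<close>.\<close>

lemma prob_void_event:
  assumes A: "A \<in> fmeasurable lborel" "A' \<in> fmeasurable lborel"
  shows "prob {\<omega> \<in> space M. configuration \<omega> \<in> void_event A A'} =
    exp (- (measure lborel A + measure lborel A') / 2)"
proof -
  have [measurable]: "A \<in> sets borel" "A' \<in> sets borel" using A by (auto dest: fmeasurableD)
  define F where "F = (A - A') \<union> (A' - A)"
  have F: "F \<in> fmeasurable lborel" and C: "A \<inter> A' \<in> fmeasurable lborel"
    using A by (auto simp: F_def fmeasurable.Diff fmeasurable.Un fmeasurable_Int_fmeasurable fmeasurableD)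
  have [measurable]: "F \<in> sets borel" unfolding F_def by measurable
  let ?V = "{\<omega> \<in> space M. configuration \<omega> \<in> void_event A A'}"
  define N where "N = (\<lambda>k::nat. {\<omega> \<in> space M. configuration \<omega> \<in> void_event A A' \<and> point_count X F \<omega> = of_nat k})"
  have V: "?V \<in> sets M"
    using measurable_sets_Collect[OF measurable_configuration, of "\<lambda>c. c \<in> void_event A A'"] void_event_in_sets[OF A]
    by simp
  have N: "N k \<in> sets M" for k
  proof -
    have "{\<omega> \<in> space M. point_count X F \<omega> = of_nat k} \<in> sets M" by measurable
    with V have "?V \<inter> {\<omega> \<in> space M. point_count X F \<omega> = of_nat k} \<in> sets M" by (rule sets.Int)
    also have "?V \<inter> {\<omega> \<in> space M. point_count X F \<omega> = of_nat k} = N k" by (auto simp: N_def)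
    finally show ?thesis .
  qed
  let ?f = "measure lborel F" and ?c = "measure lborel (A \<inter> A')"
  have "(\<lambda>k. prob (N k)) sums prob (\<Union>k. N k)"
    using N by (intro finite_measure_UNION) (auto simp: disjoint_family_on_def N_def)
  moreover have "prob (N k) = exp (- ?f - ?c) * ((?f / 2) ^ k / fact k)" for k
  proof -
    have "F \<inter> (A \<inter> A') = {}" by (auto simp: F_def)
    then have "prob {\<omega> \<in> space M. point_count X F \<omega> = of_nat k \<and> point_count X (A \<inter> A') \<omega> = of_nat 0} =
      (exp (- ?f) * ?f ^ k / fact k) * exp (- ?c)"
      using prob_point_count2[of F "A \<inter> A'" k 0] prob_point_count[OF F] prob_point_count[OF C, of 0]
      by simp
    then show ?thesis
      using prob_void_event_count[OF A, folded F_def, of k] exp_add[of "- ?f" "- ?c"]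
        power_mult_distrib[of "1/2" ?f k]
      unfolding N_def by (simp only:) (simp add: field_simps)
  qed
  ultimately have "(\<lambda>k. exp (- ?f - ?c) * ((?f / 2) ^ k / fact k)) sums prob (\<Union>k. N k)" by (simp only:)
  moreover have "(\<lambda>k. exp (- ?f - ?c) * ((?f / 2) ^ k / fact k)) sums (exp (- ?f - ?c) * exp (?f / 2))"
    by (intro sums_mult exp_sums)
  ultimately have "prob (\<Union>k. N k) = exp (- ?f - ?c) * exp (?f / 2)"
    by (rule sums_unique2)
  then have Ns: "prob (\<Union>k. N k) = exp (- ?f / 2 - ?c)"
    unfolding exp_add[symmetric] by (simp add: field_simps)
  \<comment> \<open>The events \<open>N k\<close> miss only the configurations with infinitely many
    points in \<open>F\<close>, a null set.\<close>
  have VN: "prob ?V = prob (\<Union>k. N k)"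
  proof (rule measure_eq_AE)
    show "AE \<omega> in M. \<omega> \<in> ?V \<longleftrightarrow> \<omega> \<in> (\<Union>k. N k)"
      using AE_finite_points[OF F] by eventually_elim (auto simp: N_def point_count_eq_of_nat_iff)
  qed (use N V in auto)
  have fc: "?f + 2 * ?c = measure lborel A + measure lborel A'"
  proof -
    have "measure lborel A = measure lborel (A - A') + ?c" "measure lborel A' = measure lborel (A' - A) + ?c"
      using measurable_measure_Diff[of A lborel "A \<inter> A'"] measurable_measure_Diff[of A' lborel "A \<inter> A'"] A
        fmeasurableD[OF C] by (simp_all add: Diff_Int)
    moreover have "?f = measure lborel (A - A') + measure lborel (A' - A)"
      unfolding F_def using A by (intro measure_Un_AE) (auto simp: fmeasurable.Diff)
    ultimately show ?thesis by simp
  qed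
  have "- ?f / 2 - ?c = - (measure lborel A + measure lborel A') / 2" using fc by (simp add: field_simps)
  then show ?thesis unfolding VN Ns by simp
qed

end

subsection \<open>Crossings of the square and arms\<close>

lemma connected_meets_sphere:
  assumes "connected C" "x \<in> C" "y \<in> C" "dist z x \<le> r" "r \<le> dist z y"
  shows "C \<inter> sphere z r \<noteq> {}"
proof -
  have "connected (dist z ` C)"
    using assms(1) by (intro connected_continuous_image continuous_intros)
  then have "r \<in> dist z ` C"
    using assms(2-5) by (auto intro: connectedD_interval)
  then show ?thesis by auto
qed

definition transpose2 :: "real^2 \<Rightarrow> real^2" where
  "transpose2 x = (\<chi> i. if i = 1 then x $ 2 else x $ 1)"

lemma transpose2_nth [simp]: "transpose2 x $ 1 = x $ 2" "transpose2 x $ 2 = x $ 1"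
  by (simp_all add: transpose2_def)

lemma transpose2_transpose2 [simp]: "transpose2 (transpose2 x) = x"
  by (simp add: vec_eq_iff forall_2)

lemma orthogonal_transformation_transpose2: "orthogonal_transformation transpose2"
  unfolding orthogonal_transformation_def
  by (auto intro!: linearI simp: vec_eq_iff forall_2 inner_vec_def sum_2)

lemma dist_transpose2 [simp]: "dist (transpose2 x) (transpose2 y) = dist x y"
  using orthogonal_transformation_transpose2 by (simp add: orthogonal_transformation_isometry)

lemma transpose2_vimage: "transpose2 -` A = transpose2 ` A"
proof (intro set_eqI iffI)
  fix x assume "x \<in> transpose2 -` A"
  then have "transpose2 (transpose2 x) \<in> transpose2 ` A" by blast
  then show "x \<in> transpose2 ` A" by simp
qed auto

lemma transpose2_vimage_lborel:
  assumes "A \<in> fmeasurable lborel"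
  shows "transpose2 -` A \<in> fmeasurable lborel" "measure lborel (transpose2 -` A) = measure lborel A"
proof -
  have A: "A \<in> sets borel" using assms by (auto dest: fmeasurableD)
  have "continuous_on UNIV transpose2"
    by (intro linear_continuous_on linear_conv_bounded_linear[THEN iffD1]
      orthogonal_transformation_linear orthogonal_transformation_transpose2)
  then have "transpose2 \<in> borel_measurable borel" by (rule borel_measurable_continuous_onI)
  from measurable_sets[OF this A] have tA: "transpose2 -` A \<in> sets borel" by simp
  \<comment> \<open>The invariance theorems for orthogonal maps concern Lebesgue measure; Borel
    measurability of the preimage brings the result back to \<open>lborel\<close>.\<close>
  have lA: "A \<in> lmeasurable" using assms by (simp add: fmeasurable_def)
  have "transpose2 ` A \<in> lmeasurable" "measure lebesgue (transpose2 ` A) = measure lebesgue A"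
    using measurable_orthogonal_image[OF orthogonal_transformation_transpose2 lA]
      measure_orthogonal_image[OF orthogonal_transformation_transpose2 lA] by auto
  then show "transpose2 -` A \<in> fmeasurable lborel" "measure lborel (transpose2 -` A) = measure lborel A"
    using tA A by (simp_all add: transpose2_vimage[symmetric] fmeasurable_def)
qed

lemma translation_vimage_lborel:
  fixes z :: "'a::euclidean_space"
  assumes "A \<in> fmeasurable lborel"
  shows "(\<lambda>x. x - z) -` A \<in> fmeasurable lborel" "measure lborel ((\<lambda>x. x - z) -` A) = measure lborel A"
proof -
  have eq: "(\<lambda>x. x - z) = (+) (- z)" by auto
  have A: "A \<in> sets borel" using assms by (auto dest: fmeasurableD)
  have "emeasure lborel A = emeasure (distr lborel borel ((+) (- z))) A"
    by (simp add: lborel_distr_plus)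
  also have "\<dots> = emeasure lborel ((+) (- z) -` A)"
    using A by (subst emeasure_distr) auto
  finally have em: "emeasure lborel ((\<lambda>x. x - z) -` A) = emeasure lborel A" by (simp add: eq)
  have "(\<lambda>x. x - z) \<in> borel_measurable borel" by measurable
  from measurable_sets[OF this A] have "(\<lambda>x. x - z) -` A \<in> sets borel" by simp
  with em assms show "(\<lambda>x. x - z) -` A \<in> fmeasurable lborel" by (simp add: fmeasurable_def)
  show "measure lborel ((\<lambda>x. x - z) -` A) = measure lborel A" using em by (simp add: measure_def)
qed

definition left_right :: "real \<Rightarrow> config set" where
  "left_right a = connect_event (square a) {x. x $ 1 = -a} {x. x $ 1 = a}"

text \<open>A bounded ball keeps the event measurable. The radius leaves room for the whole crossed
  square as seen from any of the centres: at most \<open>a\<close> horizontally and 2 * a + a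
  vertically.\<close>

definition arm :: "real \<Rightarrow> config set" where
  "arm a = connect_event (cball 0 (4 * a)) (sphere 0 1) (sphere 0 a)"

lemma left_right_measurable: "left_right a \<in> sets config_space"
  unfolding left_right_def by (intro connect_event_measurable compact_square closed_coordinate_line)

lemma arm_measurable: "arm a \<in> sets config_space"
  unfolding arm_def by (intro connect_event_measurable) auto

text \<open>Swapping the colours makes the closed black region a white region, and transposing turns
  its bottom-top crossing into a left-right one, so both alternatives concern the same
  event.\<close>

lemma left_right_or_dual:
  assumes "a > 0"
  shows "c \<in> left_right a \<or> map_prod (image transpose2) (image transpose2) (prod.swap c) \<in> left_right a"
proof -
  have "white_region c \<union> white_region (prod.swap c) = UNIV"
    by (auto simp: white_region_def)
  then have "connects (white_region c) (square a) {x. x $ 1 = -a} {x. x $ 1 = a} \<or>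
      connects (white_region (prod.swap c)) (square a) {x. x $ 2 = -a} {x. x $ 2 = a}"
    by (intro hex_square assms closed_white_region)
  then show ?thesis
  proof
    assume "connects (white_region (prod.swap c)) (square a) {x. x $ 2 = -a} {x. x $ 2 = a}"
    then have "prod.swap c \<in> connect_event (square a) {x. x $ 2 = -a} {x. x $ 2 = a}"
      by (simp add: connect_event_def)
    then have "map_prod (image transpose2) (image transpose2) (prod.swap c) \<in> left_right a"
      unfolding left_right_def
      by (rule connect_event_isometry[rotated])
         (auto simp: square_def)
    then show ?thesis ..
  qed (simp add: left_right_def connect_event_def)
qed

lemma left_right_imp_arm:
  assumes a: "a \<ge> 1" and c: "c \<in> left_right a"
  shows "\<exists>i\<in>{- \<lceil>a\<rceil>..\<lceil>a\<rceil>}. map_prod (image (\<lambda>x. x - axis 2 (of_int i))) (image (\<lambda>x. x - axis 2 (of_int i))) c \<in> arm a"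
proof -
  obtain C p q where C: "connected C" "C \<subseteq> white_region c" "C \<subseteq> square a"
    and pq: "p \<in> C" "p $ 1 = -a" "q \<in> C" "q $ 1 = a"
    using c unfolding left_right_def connect_event_def connects_def by blast
  obtain x where x: "x \<in> C" "x $ 1 = 0"
    using connected_ivt_component_cart[OF C(1) pq(1,3), of 1 0] pq(2,4) a by auto
  define i where "i = \<lfloor>x $ 2\<rfloor>"
  define z :: "real^2" where "z = axis 2 (of_int i)"
  have z: "z $ 1 = 0" "z $ 2 = of_int i" by (simp_all add: z_def axis_def)
  have x2: "\<bar>x $ 2\<bar> \<le> a" using x(1) C(3) by (auto simp: square_def)
  have i: "i \<in> {- \<lceil>a\<rceil>..\<lceil>a\<rceil>}" using x2 unfolding i_def by (simp; linarith)
  \<comment> \<open>Rounding down can take \<open>i\<close> below -a, but by less than 1, and 1 is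
    at most \<open>a\<close>.\<close>
  have i2: "\<bar>of_int i\<bar> \<le> 2 * a" using x2 a unfolding i_def by linarith
  have dist_le: "dist z y \<le> \<bar>y $ 1\<bar> + \<bar>of_int i - y $ 2\<bar>" for y
    using norm_le_l1_cart[of "z - y"] by (simp add: dist_norm sum_2 z)
  have "dist z x \<le> 1" using dist_le[of x] x(2) unfolding i_def by linarith
  \<comment> \<open>The centre lies on the vertical axis and p on the left side, so their first
    coordinates already differ by \<open>a\<close>.\<close>
  moreover have zp: "a \<le> dist z p"
    using component_le_norm_cart[of "z - p" 1] pq(2) z(1) a by (simp add: dist_norm)
  ultimately have "C \<inter> sphere z 1 \<noteq> {}" "C \<inter> sphere z a \<noteq> {}"
    using connected_meets_sphere[OF C(1) x(1) pq(1)] a by auto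
  moreover have "C \<subseteq> cball z (4 * a)"
  proof
    fix y assume "y \<in> C"
    then have "\<bar>y $ 1\<bar> \<le> a" "\<bar>y $ 2\<bar> \<le> a" using C(3) by (auto simp: square_def)
    then show "y \<in> cball z (4 * a)" using dist_le[of y] i2 by simp
  qed
  ultimately have "c \<in> connect_event (cball z (4 * a)) (sphere z 1) (sphere z a)"
    using C(1,2) unfolding connect_event_def connects_def by blast
  then have "map_prod (image (\<lambda>x. x - z)) (image (\<lambda>x. x - z)) c \<in> arm a"
    unfolding arm_def
    by (rule connect_event_isometry[rotated]) (auto simp: dist_norm norm_minus_commute)
  with i show ?thesis unfolding z_def by blast
qed

lemma convex_voronoi_cell:
  fixes S :: "'a::real_inner set"
  shows "convex (voronoi_cell S x)"
proof -
  have "dist y x \<le> dist y z \<longleftrightarrow> inner (2 *\<^sub>R (z - x)) y \<le> inner z z - inner x x" for y z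
    unfolding dist_norm norm_le by (simp add: inner_diff inner_commute algebra_simps)
  then have "voronoi_cell S x = (\<Inter>z\<in>S. {y. inner (2 *\<^sub>R (z - x)) y \<le> inner z z - inner x x})"
    by (auto simp: voronoi_cell_def)
  then show ?thesis by (simp only: convex_INT convex_halfspace_le)
qed

lemma closed_voronoi_cell: "closed (voronoi_cell S x)"
proof -
  have "voronoi_cell S x = (\<Inter>z\<in>S. {y. dist y x \<le> dist y z})" by (auto simp: voronoi_cell_def)
  then show ?thesis by (simp add: closed_INT closed_Collect_le continuous_intros)
qed

lemma le_infdist_iff: "A \<noteq> {} \<Longrightarrow> r \<le> infdist x A \<longleftrightarrow> (\<forall>a\<in>A. r \<le> dist x a)"
  using infdist_less_iff[of A x r] by (auto simp: not_less[symmetric] Ball_def)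

section \<open>Symmetry, probability bounds and the return to Voronoi paths\<close>

context critical_voronoi
begin

text \<open>The void probability depends only on the sum of the two areas, so a map that pulls void
  events back to void events with the same sum preserves the law, even if it exchanges the colours.
  With \<open>g\<close> the identity, the first part gives measurability of events of the
  configuration.\<close>

lemma prob_transform:
  assumes g: "\<And>A A'. A \<in> fmeasurable lborel \<Longrightarrow> A' \<in> fmeasurable lborel \<Longrightarrow>
      \<exists>D D'. D \<in> fmeasurable lborel \<and> D' \<in> fmeasurable lborel \<and>
        measure lborel D + measure lborel D' = measure lborel A + measure lborel A' \<and>
        g -` void_event A A' = void_event D D'"
    and E: "E \<in> sets config_space"
  shows "{\<omega> \<in> space M. g (configuration \<omega>) \<in> E} \<in> sets M"
    and "prob {\<omega> \<in> space M. g (configuration \<omega>) \<in> E} = prob {\<omega> \<in> space M. configuration \<omega> \<in> E}"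
proof -
  let ?g = "\<lambda>\<omega>. g (configuration \<omega>)"
  have conf: "configuration \<in> measurable M config_space" by measurable
  have pre: "h -` F \<inter> space M = {\<omega> \<in> space M. h \<omega> \<in> F}" for h and F :: "config set" by auto
  have meas: "?g \<in> measurable M config_space"
  proof (rule measurable_into_config_space)
    fix A A' :: "(real^2) set" assume A: "A \<in> fmeasurable lborel" "A' \<in> fmeasurable lborel"
    obtain D D' where D: "D \<in> fmeasurable lborel" "D' \<in> fmeasurable lborel" "g -` void_event A A' = void_event D D'"
      using g[OF A] by blast
    have "{\<omega> \<in> space M. g (configuration \<omega>) \<in> void_event A A'} = configuration -` void_event D D' \<inter> space M"
      unfolding D(3)[symmetric] by auto
    also have "\<dots> \<in> sets M" by (rule measurable_sets[OF conf void_event_in_sets[OF D(1,2)]])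
    finally show "{\<omega> \<in> space M. g (configuration \<omega>) \<in> void_event A A'} \<in> sets M" .
  qed
  show "{\<omega> \<in> space M. g (configuration \<omega>) \<in> E} \<in> sets M"
    using measurable_sets[OF meas E] unfolding pre .
  have "distr M config_space ?g = distr M config_space configuration"
  proof (rule distr_config_space_eqI[OF prob_space_axioms meas conf])
    fix A A' :: "(real^2) set" assume A: "A \<in> fmeasurable lborel" "A' \<in> fmeasurable lborel"
    obtain D D' where D: "D \<in> fmeasurable lborel" "D' \<in> fmeasurable lborel" "g -` void_event A A' = void_event D D'"
      "measure lborel D + measure lborel D' = measure lborel A + measure lborel A'"
      using g[OF A] by blast
    have "{\<omega> \<in> space M. g (configuration \<omega>) \<in> void_event A A'} = {\<omega> \<in> space M. configuration \<omega> \<in> void_event D D'}"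
      unfolding D(3)[symmetric] by auto
    then show "prob {\<omega> \<in> space M. g (configuration \<omega>) \<in> void_event A A'} =
        prob {\<omega> \<in> space M. configuration \<omega> \<in> void_event A A'}"
      by (simp add: prob_void_event A D)
  qed
  then have "measure (distr M config_space ?g) E = measure (distr M config_space configuration) E" by simp
  then show "prob {\<omega> \<in> space M. g (configuration \<omega>) \<in> E} = prob {\<omega> \<in> space M. configuration \<omega> \<in> E}"
    unfolding measure_distr[OF meas E] measure_distr[OF conf E] pre .
qed

lemma map_prod_image_vimage_void_event:
  "map_prod (image f) (image f) -` void_event A A' = void_event (f -` A) (f -` A')"
  by (auto simp: void_event_def)

lemma prob_left_right:
  assumes a: "a > 0"
  shows "prob {\<omega> \<in> space M. configuration \<omega> \<in> left_right a} \<ge> 1/2"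
proof -
  define g where "g = (\<lambda>c. map_prod (image transpose2) (image transpose2) (prod.swap c))"
  have g: "\<exists>D D'. D \<in> fmeasurable lborel \<and> D' \<in> fmeasurable lborel \<and>
        measure lborel D + measure lborel D' = measure lborel A + measure lborel A' \<and>
        g -` void_event A A' = void_event D D'"
    if "A \<in> fmeasurable lborel" "A' \<in> fmeasurable lborel" for A A'
  proof (intro exI conjI)
    show "transpose2 -` A' \<in> fmeasurable lborel" "transpose2 -` A \<in> fmeasurable lborel"
      using that transpose2_vimage_lborel by auto
    show "measure lborel (transpose2 -` A') + measure lborel (transpose2 -` A) = measure lborel A + measure lborel A'"
      using that transpose2_vimage_lborel by simp
    show "g -` void_event A A' = void_event (transpose2 -` A') (transpose2 -` A)"
      by (auto simp: g_def void_event_def)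
  qed
  note * = prob_transform[of g, OF g left_right_measurable[of a]]
  have "{\<omega> \<in> space M. configuration \<omega> \<in> left_right a} \<in> sets M"
    using prob_transform(1)[of id, OF _ left_right_measurable[of a]] by auto
  then have "prob ({\<omega> \<in> space M. configuration \<omega> \<in> left_right a} \<union> {\<omega> \<in> space M. g (configuration \<omega>) \<in> left_right a})
      \<le> prob {\<omega> \<in> space M. configuration \<omega> \<in> left_right a} + prob {\<omega> \<in> space M. g (configuration \<omega>) \<in> left_right a}"
    using *(1) by (intro measure_Un_le)
  moreover have "{\<omega> \<in> space M. configuration \<omega> \<in> left_right a} \<union> {\<omega> \<in> space M. g (configuration \<omega>) \<in> left_right a} = space M"
    using left_right_or_dual[OF a] unfolding g_def by blast
  ultimately show ?thesis using *(2) by (simp add: prob_space)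
qed

lemma prob_arm:
  assumes a: "a \<ge> 1"
  shows "prob {\<omega> \<in> space M. configuration \<omega> \<in> arm a} \<ge> 1 / (10 * a)"
proof -
  define g :: "int \<Rightarrow> config \<Rightarrow> config" where
    "g = (\<lambda>i. map_prod (image (\<lambda>x. x - axis 2 (of_int i))) (image (\<lambda>x. x - axis 2 (of_int i))))"
  have g: "\<exists>D D'. D \<in> fmeasurable lborel \<and> D' \<in> fmeasurable lborel \<and>
        measure lborel D + measure lborel D' = measure lborel A + measure lborel A' \<and>
        g i -` void_event A A' = void_event D D'"
    if "A \<in> fmeasurable lborel" "A' \<in> fmeasurable lborel" for A A' i
    unfolding g_def map_prod_image_vimage_void_event
    using that by (intro exI conjI refl) (auto simp: translation_vimage_lborel)
  note * = prob_transform[of "g i" for i, OF g arm_measurable[of a]]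
  let ?I = "{- \<lceil>a\<rceil>..\<lceil>a\<rceil>}" and ?p = "prob {\<omega> \<in> space M. configuration \<omega> \<in> arm a}"
  have "1/2 \<le> prob {\<omega> \<in> space M. configuration \<omega> \<in> left_right a}"
    using a by (intro prob_left_right) simp
  also have "\<dots> \<le> prob (\<Union>i\<in>?I. {\<omega> \<in> space M. g i (configuration \<omega>) \<in> arm a})"
  proof (rule finite_measure_mono)
    show "{\<omega> \<in> space M. configuration \<omega> \<in> left_right a} \<subseteq> (\<Union>i\<in>?I. {\<omega> \<in> space M. g i (configuration \<omega>) \<in> arm a})"
      using left_right_imp_arm[OF a] unfolding g_def by blast
    show "(\<Union>i\<in>?I. {\<omega> \<in> space M. g i (configuration \<omega>) \<in> arm a}) \<in> sets M"
      using *(1) by (intro sets.finite_UN) auto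
  qed
  also have "\<dots> \<le> (\<Sum>i\<in>?I. prob {\<omega> \<in> space M. g i (configuration \<omega>) \<in> arm a})"
    using *(1) by (intro finite_measure_subadditive_finite) auto
  also have "\<dots> = real (card ?I) * ?p" by (simp add: *(2))
  also have "\<dots> \<le> (5 * a) * ?p"
  proof (rule mult_right_mono)
    \<comment> \<open>The number of discs is at most 2 * (a + 1) + 1 = 2 * a + 3, and 3 is at most 3
      * a.\<close>
    have "real (card ?I) = of_int (2 * \<lceil>a\<rceil> + 1)" using a by simp
    also have "\<dots> \<le> 5 * a" using a by linarith
    finally show "real (card ?I) \<le> 5 * a" .
  qed simp
  finally show ?thesis using a by (simp add: field_simps)
qed

text \<open>If a colour is absent, it is absent from a square of area 4 n^2, which has probability
  exp(-2 n^2). This rules out the configurations on which \<open>white_region\<close> is distorted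
  by \<open>infdist\<close> to the empty set.\<close>

lemma AE_both_colours: "AE \<omega> in M. fst (configuration \<omega>) \<noteq> {} \<and> snd (configuration \<omega>) \<noteq> {}"
proof -
  have sq: "square (real n) \<in> fmeasurable lborel" for n
    using compact_square by (intro fmeasurable_compact)
  have sq_m: "measure lborel (square (real n)) = 4 * (real n)\<^sup>2" for n
  proof -
    have "cbox (\<chi> i::2. - real n) (\<chi> i. real n) \<noteq> {}"
      by (simp add: interval_ne_empty_cart)
    then show ?thesis
      by (simp add: square_eq_cbox content_cbox_cart power2_eq_square)
  qed
  have meas: "{\<omega> \<in> space M. configuration \<omega> \<in> E} \<in> sets M" if "E \<in> sets config_space" for E
    using prob_transform(1)[of id, OF _ that] by auto
  have "AE \<omega> in M. configuration \<omega> \<notin> E"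
    if E: "E \<in> sets config_space"
      and sub: "\<And>n. \<exists>A A'. A \<in> fmeasurable lborel \<and> A' \<in> fmeasurable lborel \<and> E \<subseteq> void_event A A' \<and>
        measure lborel A + measure lborel A' = 4 * (real n)\<^sup>2" for E
  proof -
    have le: "prob {\<omega> \<in> space M. configuration \<omega> \<in> E} \<le> 1 / real (Suc n)" for n
    proof -
      obtain A A' where A: "A \<in> fmeasurable lborel" "A' \<in> fmeasurable lborel" "E \<subseteq> void_event A A'"
        "measure lborel A + measure lborel A' = 4 * (real (Suc n))\<^sup>2" using sub by blast
      have "prob {\<omega> \<in> space M. configuration \<omega> \<in> E} \<le> prob {\<omega> \<in> space M. configuration \<omega> \<in> void_event A A'}"
        using A(3) meas[OF void_event_in_sets[OF A(1,2)]] by (intro finite_measure_mono) auto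
      also have "\<dots> = inverse (exp (2 * (real (Suc n))\<^sup>2))"
        unfolding prob_void_event[OF A(1,2)] A(4) by (simp add: exp_minus)
      also have "\<dots> \<le> inverse (real (Suc n))"
      proof (rule le_imp_inverse_le)
        have sq_le: "s \<le> 1 + 2 * s\<^sup>2" if "s \<ge> 1" for s :: real
          using mult_left_mono[OF that, of s] that unfolding power2_eq_square by linarith
        have "real (Suc n) \<le> 1 + 2 * (real (Suc n))\<^sup>2"
          by (rule sq_le) simp
        also have "\<dots> \<le> exp (2 * (real (Suc n))\<^sup>2)" by (rule exp_ge_add_one_self)
        finally show "real (Suc n) \<le> exp (2 * (real (Suc n))\<^sup>2)" .
      qed simp
      finally show ?thesis by (simp add: inverse_eq_divide)
    qed
    have "prob {\<omega> \<in> space M. configuration \<omega> \<in> E} = 0"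
    proof (rule ccontr)
      assume "prob {\<omega> \<in> space M. configuration \<omega> \<in> E} \<noteq> 0"
      then have "prob {\<omega> \<in> space M. configuration \<omega> \<in> E} > 0" by (simp add: less_le)
      then obtain n where "1 / real (Suc n) < prob {\<omega> \<in> space M. configuration \<omega> \<in> E}"
        by (rule nat_approx_posE)
      then show False using le[of n] by simp
    qed
    then have "AE \<omega> in M. \<omega> \<notin> {\<omega> \<in> space M. configuration \<omega> \<in> E}"
      using prob_eq_0[OF meas[OF E]] by simp
    then show ?thesis using AE_space by eventually_elim simp
  qed
  note AE_notin = this
  have "AE \<omega> in M. configuration \<omega> \<notin> {c. fst c = {}}"
  proof (rule AE_notin)
    show "{c. fst c = {}} \<in> sets config_space"
      by (rule borel_measurable_infdist_config(1)[OF measurable_hits_fst[OF ball_fmeasurable]])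
    show "\<exists>A A'. A \<in> fmeasurable lborel \<and> A' \<in> fmeasurable lborel \<and> {c. fst c = {}} \<subseteq> void_event A A' \<and>
        measure lborel A + measure lborel A' = 4 * (real n)\<^sup>2" for n
      by (rule exI[of _ "square (real n)"], rule exI[of _ "{}"]) (intro conjI fmeasurable.empty_sets sq; auto simp: sq_m void_event_def)
  qed
  moreover have "AE \<omega> in M. configuration \<omega> \<notin> {c. snd c = {}}"
  proof (rule AE_notin)
    show "{c. snd c = {}} \<in> sets config_space"
      by (rule borel_measurable_infdist_config(1)[OF measurable_hits_snd[OF ball_fmeasurable]])
    show "\<exists>A A'. A \<in> fmeasurable lborel \<and> A' \<in> fmeasurable lborel \<and> {c. snd c = {}} \<subseteq> void_event A A' \<and>
        measure lborel A + measure lborel A' = 4 * (real n)\<^sup>2" for n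
      by (rule exI[of _ "{}"], rule exI[of _ "square (real n)"]) (intro conjI fmeasurable.empty_sets sq; auto simp: sq_m void_event_def)
  qed
  ultimately show ?thesis by eventually_elim simp
qed

lemma AE_locally_finite: "AE \<omega> in M. \<forall>r. finite {n. X n \<omega> \<in> cball 0 r}"
proof -
  have "AE \<omega> in M. \<forall>m::nat. finite {n. X n \<omega> \<in> ball 0 (real m)}"
    unfolding AE_all_countable using AE_finite_points[OF ball_fmeasurable] by blast
  then show ?thesis
  proof eventually_elim
    fix \<omega> assume fin: "\<forall>m::nat. finite {n. X n \<omega> \<in> ball 0 (real m)}"
    show "\<forall>r. finite {n. X n \<omega> \<in> cball 0 r}"
    proof
      fix r
      obtain m :: nat where "r < real m" using reals_Archimedean2 by blast
      then have "{n. X n \<omega> \<in> cball 0 r} \<subseteq> {n. X n \<omega> \<in> ball 0 (real m)}" by auto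
      then show "finite {n. X n \<omega> \<in> cball 0 r}" using fin finite_subset by blast
    qed
  qed
qed

text \<open>Local finiteness makes the distance to the white points attained. A white point at least
  as close as every black one is then a nearest point overall, so its cell contains y.\<close>

lemma voronoi_white_eq_white_region:
  assumes ne: "fst (configuration \<omega>) \<noteq> {}" "snd (configuration \<omega>) \<noteq> {}"
    and fin: "\<And>r. finite {n. X n \<omega> \<in> cball 0 r}"
  shows "{y. voronoi_colouring X B \<omega> y = 0} = white_region (configuration \<omega>)"
proof -
  have "y \<in> white_region (configuration \<omega>) \<longleftrightarrow>
      (\<exists>n. y \<in> voronoi_cell (range (\<lambda>k. X k \<omega>)) (X n \<omega>) \<and> \<not> B n \<omega>)" (is "?l \<longleftrightarrow> ?r") for y
  proof
    assume ?r
    then obtain n where n: "\<And>k. dist y (X n \<omega>) \<le> dist y (X k \<omega>)" "\<not> B n \<omega>"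
      by (auto simp: voronoi_cell_def)
    have "infdist y (fst (configuration \<omega>)) \<le> dist y (X n \<omega>)"
      using n(2) by (intro infdist_le) (auto simp: configuration_def)
    also have "\<dots> \<le> infdist y (snd (configuration \<omega>))"
      using n(1) by (subst le_infdist_iff[OF ne(2)]) (auto simp: configuration_def)
    finally show ?l by (simp add: white_region_def)
  next
    assume l: ?l
    obtain n0 where n0: "\<not> B n0 \<omega>" using ne(1) by (auto simp: configuration_def)
    \<comment> \<open>Only white points no farther than one chosen white point compete for the
      minimum, and these lie in a bounded region.\<close>
    define J where "J = {n. \<not> B n \<omega> \<and> dist y (X n \<omega>) \<le> dist y (X n0 \<omega>)}"
    have "J \<subseteq> {n. X n \<omega> \<in> cball 0 (norm y + dist y (X n0 \<omega>))}"
    proof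
      fix n assume "n \<in> J"
      then have "dist y (X n \<omega>) \<le> dist y (X n0 \<omega>)" by (simp add: J_def)
      then show "n \<in> {n. X n \<omega> \<in> cball 0 (norm y + dist y (X n0 \<omega>))}"
        using dist_triangle2[of 0 "X n \<omega>" y] by (simp add: dist_norm norm_minus_commute)
    qed
    then have "finite J" using fin finite_subset by blast
    moreover have "J \<noteq> {}" using n0 by (auto simp: J_def)
    ultimately obtain n where n: "n \<in> J" "\<And>k. k \<in> J \<Longrightarrow> dist y (X n \<omega>) \<le> dist y (X k \<omega>)"
      using arg_min_if_finite[of J "\<lambda>n. dist y (X n \<omega>)"] by (meson not_le_imp_less)
    have min: "dist y (X n \<omega>) \<le> dist y (X k \<omega>)" if "\<not> B k \<omega>" for k
      using n that by (cases "k \<in> J") (auto simp: J_def)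
    have "dist y (X n \<omega>) \<le> infdist y (fst (configuration \<omega>))"
      using min by (subst le_infdist_iff[OF ne(1)]) (auto simp: configuration_def)
    also have "\<dots> \<le> infdist y (snd (configuration \<omega>))" using l by (simp add: white_region_def)
    finally have "dist y (X n \<omega>) \<le> dist y (X k \<omega>)" if "B k \<omega>" for k
      using that by (subst (asm) le_infdist_iff[OF ne(2)]) (auto simp: configuration_def)
    with min have "dist y (X n \<omega>) \<le> dist y (X k \<omega>)" for k by blast
    then show ?r using n(1) by (auto simp: voronoi_cell_def J_def)
  qed
  then show ?thesis by (auto simp: voronoi_colouring_def)
qed

text \<open>A path is compact and so lies in some ball \<open>cball 0 m\<close>. Conversely, a
  connected white set in a ball is covered by finitely many white cells, whose convexity provides a
  path.\<close>

lemma crosses_annulus_iff: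
  assumes ne: "fst (configuration \<omega>) \<noteq> {}" "snd (configuration \<omega>) \<noteq> {}"
    and fin: "\<And>r. finite {n. X n \<omega> \<in> cball 0 r}"
  shows "crosses_annulus {y. voronoi_colouring X B \<omega> y = 0} R \<longleftrightarrow>
    (\<exists>m::nat. configuration \<omega> \<in> connect_event (cball 0 (real m)) (sphere 0 1) (sphere 0 R))"
proof -
  let ?W = "{y. voronoi_colouring X B \<omega> y = 0}"
  let ?cell = "\<lambda>n. voronoi_cell (range (\<lambda>k. X k \<omega>)) (X n \<omega>)"
  have W: "?W = white_region (configuration \<omega>)" by (rule voronoi_white_eq_white_region[OF assms])
  have cells: "y \<in> ?W \<longleftrightarrow> (\<exists>n. y \<in> ?cell n \<and> \<not> B n \<omega>)" for y
    by (simp add: voronoi_colouring_def)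
  show ?thesis
  proof
    assume "crosses_annulus ?W R"
    then obtain g where g: "path g" "path_image g \<subseteq> ?W" "pathstart g \<in> sphere 0 1" "pathfinish g \<in> sphere 0 R"
      unfolding crosses_annulus_def by blast
    obtain b where "path_image g \<subseteq> cball 0 b"
      using bounded_path_image[OF g(1)] by (metis ball_subset_cball bounded_subset_ballD order_trans)
    moreover obtain m :: nat where "b \<le> real m" using real_arch_simple by blast
    ultimately have "path_image g \<subseteq> cball 0 (real m)" by (meson order_trans subset_cball)
    then have "connects ?W (cball 0 (real m)) (sphere 0 1) (sphere 0 R)"
      unfolding connects_def using g connected_path_image[OF g(1)] pathstart_in_path_image[of g]
        pathfinish_in_path_image[of g] by blast
    then show "\<exists>m::nat. configuration \<omega> \<in> connect_event (cball 0 (real m)) (sphere 0 1) (sphere 0 R)"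
      unfolding connect_event_def W by blast
  next
    assume "\<exists>m::nat. configuration \<omega> \<in> connect_event (cball 0 (real m)) (sphere 0 1) (sphere 0 R)"
    then obtain m C x y where C: "connected C" "C \<subseteq> ?W" "C \<subseteq> cball 0 (real m)"
      and xy: "x \<in> C" "x \<in> sphere 0 1" "y \<in> C" "y \<in> sphere 0 R"
      unfolding connect_event_def connects_def W by blast
    \<comment> \<open>If u in the ball lies in the cell of \<open>X n\<close>, then
      \<open>X n\<close> is no farther from u than \<open>X 0\<close> is, so its norm is at most 2 *
      |u| + |X 0|.\<close>
    define J where "J = {n. \<not> B n \<omega> \<and> X n \<omega> \<in> cball 0 (2 * real m + norm (X 0 \<omega>))}"
    have "finite J" using fin[of "2 * real m + norm (X 0 \<omega>)"] by (rule finite_subset[rotated]) (auto simp: J_def)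
    moreover have "C \<subseteq> \<Union>(?cell ` J)"
    proof
      fix u assume u: "u \<in> C"
      then obtain n where n: "u \<in> ?cell n" "\<not> B n \<omega>" using C(2) cells by blast
      then have "dist u (X n \<omega>) \<le> dist u (X 0 \<omega>)" by (auto simp: voronoi_cell_def)
      moreover have "norm u \<le> real m" using u C(3) by auto
      moreover have "norm (X n \<omega>) \<le> norm u + dist u (X n \<omega>)"
        using norm_triangle_ineq4[of u "u - X n \<omega>"] by (simp add: dist_norm)
      moreover have "dist u (X 0 \<omega>) \<le> norm u + norm (X 0 \<omega>)"
        unfolding dist_norm by (rule norm_triangle_ineq4)
      ultimately have "n \<in> J" using n(2) by (simp add: J_def)
      with n(1) show "u \<in> \<Union>(?cell ` J)" by blast
    qed
    ultimately have "path_component (\<Union>(?cell ` J)) x y"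
      using C(1) xy(1,3) convex_voronoi_cell closed_voronoi_cell
      by (intro path_component_finite_Union_convex[of "?cell ` J" C]) auto
    then obtain g where g: "path g" "path_image g \<subseteq> \<Union>(?cell ` J)" "pathstart g = x" "pathfinish g = y"
      unfolding path_component_def by blast
    have "\<Union>(?cell ` J) \<subseteq> ?W" using cells by (auto simp: J_def)
    then have "path_image g \<subseteq> ?W" using g(2) by (rule order_trans[rotated])
    then show "crosses_annulus ?W R"
      unfolding crosses_annulus_def using g(1,3,4) xy(2,4) by blast
  qed
qed

lemma prob_Cross0:
  assumes R: "R \<ge> 1"
  shows "measure (completion M) (Cross0 M X B R) \<ge> 1 / (10 * R)"
proof -
  let ?E = "\<lambda>m::nat. {\<omega> \<in> space M. configuration \<omega> \<in> connect_event (cball 0 (real m)) (sphere 0 1) (sphere 0 R)}"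
  have E: "?E m \<in> sets M" for m
    by (rule prob_transform(1)[of id, simplified, OF _ connect_event_measurable]) auto
  define S where "S = (\<Union>m. ?E m)"
  have S: "S \<in> sets M" unfolding S_def using E by blast
  have AE: "AE \<omega> in M. \<omega> \<in> Cross0 M X B R \<longleftrightarrow> \<omega> \<in> S"
    using AE_both_colours AE_locally_finite AE_space
    by eventually_elim (simp add: Cross0_def S_def crosses_annulus_iff)
  \<comment> \<open>\<open>D\<close> lies in a null set, so it is measurable in the completion;
    \<open>Cross0\<close> is recovered as the symmetric difference of \<open>S\<close> and
    \<open>D\<close>.\<close>
  define D where "D = {\<omega> \<in> space M. \<not> (\<omega> \<in> Cross0 M X B R \<longleftrightarrow> \<omega> \<in> S)}"
  have "Measurable.pred (completion M) (\<lambda>\<omega>. \<not> (\<omega> \<in> Cross0 M X B R \<longleftrightarrow> \<omega> \<in> S))"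
    using AE by (intro sets_completion_AE) simp
  then have "D \<in> sets (completion M)" by (simp add: pred_def D_def)
  moreover have "S \<in> sets (completion M)" using S by simp
  moreover have "Cross0 M X B R = (S - D) \<union> (D - S)"
    using sets.sets_into_space[OF S] by (auto simp: D_def Cross0_def)
  ultimately have "Cross0 M X B R \<in> sets (completion M)" by auto
  then have "measure (completion M) (Cross0 M X B R) = measure (completion M) S"
    using S by (intro measure_eq_AE AE_completion AE) auto
  also have "\<dots> = prob S" using S by simp
  also have "prob S \<ge> prob {\<omega> \<in> space M. configuration \<omega> \<in> arm R}"
  proof (rule finite_measure_mono[OF _ S])
    obtain m :: nat where m: "4 * R \<le> real m" using real_arch_simple by blast
    have "arm R \<subseteq> connect_event (cball 0 (real m)) (sphere 0 1) (sphere 0 R)"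
      unfolding arm_def connect_event_def using connects_mono subset_cball[OF m] by blast
    then show "{\<omega> \<in> space M. configuration \<omega> \<in> arm R} \<subseteq> S" unfolding S_def by blast
  qed
  finally show ?thesis using prob_arm[OF R] by linarith
qed

end

theorem corollary3p11:
  fixes M :: "'w measure" and X :: "nat \<Rightarrow> 'w \<Rightarrow> real^2" and B :: "nat \<Rightarrow> 'w \<Rightarrow> bool"
  assumes "voronoi_percolation M (1/2) X B"
  shows "\<forall>\<eta>::real. \<eta> > 0 \<longrightarrow>
    Limsup at_top (\<lambda>R::real. ereal (R powr (1 + \<eta>) * measure (completion M) (Cross0 M X B R))) > 0"
proof (intro allI impI)
  fix \<eta> :: real assume \<eta>: "\<eta> > 0"
  interpret critical_voronoi M X B
    using assms by (simp add: critical_voronoi_def)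
  have "1/10 \<le> R powr (1 + \<eta>) * measure (completion M) (Cross0 M X B R)" if R: "R \<ge> 1" for R :: real
  proof -
    \<comment> \<open>One factor R cancels the decay 1 / (10 * R) of the one-arm bound; the
      remaining \<open>R powr \<eta>\<close> is at least 1.\<close>
    have "1/10 \<le> R powr \<eta> / 10" using R \<eta> by (simp add: ge_one_powr_ge_zero)
    also have "\<dots> = R powr (1 + \<eta>) * (1 / (10 * R))" using R by (simp add: powr_add)
    also have "\<dots> \<le> R powr (1 + \<eta>) * measure (completion M) (Cross0 M X B R)"
      using prob_Cross0[OF R] by (intro mult_left_mono) auto
    finally show ?thesis .
  qed
  then have "\<forall>\<^sub>F R in at_top. ereal (1/10) \<le> ereal (R powr (1 + \<eta>) * measure (completion M) (Cross0 M X B R))"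
    by (auto intro: eventually_mono[OF eventually_ge_at_top[of 1]])
  then have "ereal (1/10) \<le> Limsup at_top (\<lambda>R::real. ereal (R powr (1 + \<eta>) * measure (completion M) (Cross0 M X B R)))"
    by (intro le_Limsup) auto
  then show "Limsup at_top (\<lambda>R::real. ereal (R powr (1 + \<eta>) * measure (completion M) (Cross0 M X B R))) > 0"
    by (rule less_le_trans[rotated]) simp
qed

end
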